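(* Let $G$ be a group, let $I$ be an infinite set, and let $S$ be the Brandt semigroup over $G$ with index set $I$. Then the convolution algebra $\ell^1(S)$ is not approximately amenable.
   Context: The Brandt semigroup over $G$ with index set $I$ is $S=(I\times G\times I)\cup\{\theta\}$, where $\theta$ is a zero element (that is, $\theta s=s\theta=\theta$ for all $s\in S$) and $(i,g,j)(k,h,l)=(i,gh,l)$ if $j=k$, and $=\theta$ if $j\neq k$. The Banach algebra $\ell^1(S)$ has the $\ell^1$-norm and the convolution product determined by $\delta_s*\delta_t=\delta_{st}$. A continuous derivation $D$ from a Banach algebra $\mathcal{A}$ into a Banach $\mathcal{A}$-bimodule $Y$ is approximately inner if there is a net $(y_i)$ in $Y$ such that $D(a)=\lim_i (a\cdot y_i-y_i\cdot a)$ in norm for every $a\in\mathcal{A}$. The Banach algebra $\mathcal{A}$ is approximately amenable if, for every Banach $\mathcal{A}$-bimodule $X$, every continuous derivation from $\mathcal{A}$ into the dual bimodule $X^*$ is approximately inner. *)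

theory Defs
  imports "HOL-Analysis.Infinite_Sum" "HOL-Algebra.Module"
begin

section \<open>Complex Banach spaces with explicit carriers\<close>

text \<open>
  The definition of approximate amenability quantifies over all Banach bimodules, so Banach
  spaces are records with a carrier set. The algebraic part is a HOL-Algebra module over the
  field of complex numbers. The fields \<open>mult\<close> and \<open>one\<close> inherited by the record carry no
  information for a Banach space; for a Banach algebra \<open>mult\<close> is the product and \<open>one\<close> is
  still unused, as algebras need not be unital.
\<close>

definition complex_ring :: "complex ring" where
  "complex_ring = \<lparr>carrier = UNIV, monoid.mult = (*), one = 1, zero = 0, add = (+)\<rparr>"

record 'x normed_module = "(complex, 'x) module" +
  nrm :: "'x \<Rightarrow> real" (\<open>\<nu>\<index>\<close>)

locale complex_banach_space = module complex_ring X for X (structure) +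
  assumes nrm_eq_0: "x \<in> carrier X \<Longrightarrow> \<nu> x = 0 \<longleftrightarrow> x = \<zero>"
    and nrm_triangle: "x \<in> carrier X \<Longrightarrow> y \<in> carrier X \<Longrightarrow> \<nu> (x \<oplus> y) \<le> \<nu> x + \<nu> y"
    and nrm_smult: "x \<in> carrier X \<Longrightarrow> \<nu> (c \<odot> x) = cmod c * \<nu> x"
    and complete:
      "(\<And>n. u n \<in> carrier X) \<Longrightarrow>
       (\<And>e. e > 0 \<Longrightarrow> \<exists>N. \<forall>m\<ge>N. \<forall>n\<ge>N. \<nu> (u m \<ominus> u n) < e) \<Longrightarrow>
       \<exists>x\<in>carrier X. (\<lambda>n::nat. \<nu> (u n \<ominus> x)) \<longlonglongrightarrow> 0"

locale banach_algebra = complex_banach_space A for A (structure) +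
  assumes mult_closed: "a \<in> carrier A \<Longrightarrow> b \<in> carrier A \<Longrightarrow> a \<otimes> b \<in> carrier A"
    and mult_assoc:
      "a \<in> carrier A \<Longrightarrow> b \<in> carrier A \<Longrightarrow> c \<in> carrier A \<Longrightarrow> (a \<otimes> b) \<otimes> c = a \<otimes> (b \<otimes> c)"
    and mult_add_left:
      "a \<in> carrier A \<Longrightarrow> b \<in> carrier A \<Longrightarrow> c \<in> carrier A \<Longrightarrow>
       (a \<oplus> b) \<otimes> c = (a \<otimes> c) \<oplus> (b \<otimes> c)"
    and mult_add_right:
      "a \<in> carrier A \<Longrightarrow> b \<in> carrier A \<Longrightarrow> c \<in> carrier A \<Longrightarrow>
       a \<otimes> (b \<oplus> c) = (a \<otimes> b) \<oplus> (a \<otimes> c)"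
    and mult_smult_left:
      "a \<in> carrier A \<Longrightarrow> b \<in> carrier A \<Longrightarrow> (k \<odot> a) \<otimes> b = k \<odot> (a \<otimes> b)"
    and mult_smult_right:
      "a \<in> carrier A \<Longrightarrow> b \<in> carrier A \<Longrightarrow> a \<otimes> (k \<odot> b) = k \<odot> (a \<otimes> b)"
    and nrm_mult: "a \<in> carrier A \<Longrightarrow> b \<in> carrier A \<Longrightarrow> \<nu> (a \<otimes> b) \<le> \<nu> a * \<nu> b"


section \<open>Banach bimodules and their duals\<close>

record ('a, 'x) normed_bimodule = "'x normed_module" +
  lact :: "'a \<Rightarrow> 'x \<Rightarrow> 'x"
  ract :: "'x \<Rightarrow> 'a \<Rightarrow> 'x"

locale banach_bimodule = A: banach_algebra A + X: complex_banach_space X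
  for A :: "('a, 'm) normed_module_scheme" and X :: "('a, 'x) normed_bimodule" +
  assumes lact_closed: "a \<in> carrier A \<Longrightarrow> x \<in> carrier X \<Longrightarrow> lact X a x \<in> carrier X"
    and ract_closed: "a \<in> carrier A \<Longrightarrow> x \<in> carrier X \<Longrightarrow> ract X x a \<in> carrier X"
    and lact_add:
      "a \<in> carrier A \<Longrightarrow> x \<in> carrier X \<Longrightarrow> y \<in> carrier X \<Longrightarrow>
       lact X a (x \<oplus>\<^bsub>X\<^esub> y) = lact X a x \<oplus>\<^bsub>X\<^esub> lact X a y"
    and ract_add:
      "a \<in> carrier A \<Longrightarrow> x \<in> carrier X \<Longrightarrow> y \<in> carrier X \<Longrightarrow>
       ract X (x \<oplus>\<^bsub>X\<^esub> y) a = ract X x a \<oplus>\<^bsub>X\<^esub> ract X y a"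
    and lact_smult:
      "a \<in> carrier A \<Longrightarrow> x \<in> carrier X \<Longrightarrow> lact X a (k \<odot>\<^bsub>X\<^esub> x) = k \<odot>\<^bsub>X\<^esub> lact X a x"
    and ract_smult:
      "a \<in> carrier A \<Longrightarrow> x \<in> carrier X \<Longrightarrow> ract X (k \<odot>\<^bsub>X\<^esub> x) a = k \<odot>\<^bsub>X\<^esub> ract X x a"
    and lact_add_alg:
      "a \<in> carrier A \<Longrightarrow> b \<in> carrier A \<Longrightarrow> x \<in> carrier X \<Longrightarrow>
       lact X (a \<oplus>\<^bsub>A\<^esub> b) x = lact X a x \<oplus>\<^bsub>X\<^esub> lact X b x"
    and ract_add_alg:
      "a \<in> carrier A \<Longrightarrow> b \<in> carrier A \<Longrightarrow> x \<in> carrier X \<Longrightarrow>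
       ract X x (a \<oplus>\<^bsub>A\<^esub> b) = ract X x a \<oplus>\<^bsub>X\<^esub> ract X x b"
    and lact_smult_alg:
      "a \<in> carrier A \<Longrightarrow> x \<in> carrier X \<Longrightarrow> lact X (k \<odot>\<^bsub>A\<^esub> a) x = k \<odot>\<^bsub>X\<^esub> lact X a x"
    and ract_smult_alg:
      "a \<in> carrier A \<Longrightarrow> x \<in> carrier X \<Longrightarrow> ract X x (k \<odot>\<^bsub>A\<^esub> a) = k \<odot>\<^bsub>X\<^esub> ract X x a"
    and lact_mult:
      "a \<in> carrier A \<Longrightarrow> b \<in> carrier A \<Longrightarrow> x \<in> carrier X \<Longrightarrow>
       lact X (a \<otimes>\<^bsub>A\<^esub> b) x = lact X a (lact X b x)"
    and ract_mult:
      "a \<in> carrier A \<Longrightarrow> b \<in> carrier A \<Longrightarrow> x \<in> carrier X \<Longrightarrow>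
       ract X x (a \<otimes>\<^bsub>A\<^esub> b) = ract X (ract X x a) b"
    and lact_ract:
      "a \<in> carrier A \<Longrightarrow> b \<in> carrier A \<Longrightarrow> x \<in> carrier X \<Longrightarrow>
       ract X (lact X a x) b = lact X a (ract X x b)"
    and lact_bounded:
      "\<exists>C. \<forall>a\<in>carrier A. \<forall>x\<in>carrier X. nrm X (lact X a x) \<le> C * nrm A a * nrm X x"
    and ract_bounded:
      "\<exists>C. \<forall>a\<in>carrier A. \<forall>x\<in>carrier X. nrm X (ract X x a) \<le> C * nrm A a * nrm X x"

text \<open>Functionals are set to 0 outside the carrier, so that equality of functionals is equality
  of HOL functions and the operations of the dual are pointwise.\<close>

definition bounded_functional :: "('x, 'm) normed_module_scheme \<Rightarrow> ('x \<Rightarrow> complex) \<Rightarrow> bool" where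
  "bounded_functional X \<phi> \<longleftrightarrow>
     (\<forall>x\<in>carrier X. \<forall>y\<in>carrier X. \<phi> (x \<oplus>\<^bsub>X\<^esub> y) = \<phi> x + \<phi> y) \<and>
     (\<forall>k. \<forall>x\<in>carrier X. \<phi> (k \<odot>\<^bsub>X\<^esub> x) = k * \<phi> x) \<and>
     (\<exists>C. \<forall>x\<in>carrier X. cmod (\<phi> x) \<le> C * nrm X x) \<and>
     (\<forall>x. x \<notin> carrier X \<longrightarrow> \<phi> x = 0)"

definition dual_bimodule :: "('a, 'x) normed_bimodule \<Rightarrow> ('a, 'x \<Rightarrow> complex) normed_bimodule" where
  "dual_bimodule X =
    \<lparr>carrier = {\<phi>. bounded_functional X \<phi>},
     monoid.mult = undefined,
     one = undefined,
     zero = (\<lambda>x. 0),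
     add = (\<lambda>\<phi> \<psi> x. \<phi> x + \<psi> x),
     smult = (\<lambda>k \<phi> x. k * \<phi> x),
     nrm = (\<lambda>\<phi>. SUP x \<in> {x \<in> carrier X. nrm X x \<le> 1}. cmod (\<phi> x)),
     lact = (\<lambda>a \<phi> x. if x \<in> carrier X then \<phi> (ract X x a) else 0),
     ract = (\<lambda>\<phi> a x. if x \<in> carrier X then \<phi> (lact X a x) else 0)\<rparr>"


section \<open>Approximate amenability\<close>

definition continuous_derivation ::
    "('a, 'm) normed_module_scheme \<Rightarrow> ('a, 'y) normed_bimodule \<Rightarrow> ('a \<Rightarrow> 'y) \<Rightarrow> bool" where
  "continuous_derivation A Y D \<longleftrightarrow>
     D \<in> carrier A \<rightarrow> carrier Y \<and>
     (\<forall>a\<in>carrier A. \<forall>b\<in>carrier A. D (a \<oplus>\<^bsub>A\<^esub> b) = D a \<oplus>\<^bsub>Y\<^esub> D b) \<and>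
     (\<forall>k. \<forall>a\<in>carrier A. D (k \<odot>\<^bsub>A\<^esub> a) = k \<odot>\<^bsub>Y\<^esub> D a) \<and>
     (\<forall>a\<in>carrier A. \<forall>b\<in>carrier A. D (a \<otimes>\<^bsub>A\<^esub> b) = lact Y a (D b) \<oplus>\<^bsub>Y\<^esub> ract Y (D a) b) \<and>
     (\<forall>a\<in>carrier A. \<forall>e>0. \<exists>d>0. \<forall>b\<in>carrier A.
        nrm A (b \<ominus>\<^bsub>A\<^esub> a) < d \<longrightarrow> nrm Y (D b \<ominus>\<^bsub>Y\<^esub> D a) < e)"

text \<open>Nets in \<open>Y\<close> are expressed by proper filters on \<open>Y\<close>; \<open>approximately_inner_net\<close> and
  \<open>approximately_inner_imp_net\<close> prove the equivalence with nets indexed by directed sets.\<close>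

definition approximately_inner ::
    "('a, 'm) normed_module_scheme \<Rightarrow> ('a, 'y) normed_bimodule \<Rightarrow> ('a \<Rightarrow> 'y) \<Rightarrow> bool" where
  "approximately_inner A Y D \<longleftrightarrow>
     (\<exists>F. F \<noteq> bot \<and> (\<forall>\<^sub>F y in F. y \<in> carrier Y) \<and>
        (\<forall>a\<in>carrier A. ((\<lambda>y. nrm Y (D a \<ominus>\<^bsub>Y\<^esub> (lact Y a y \<ominus>\<^bsub>Y\<^esub> ract Y y a))) \<longlongrightarrow> 0) F))"

definition directed_on :: "'j set \<Rightarrow> ('j \<Rightarrow> 'j \<Rightarrow> bool) \<Rightarrow> bool" where
  "directed_on J below \<longleftrightarrow> J \<noteq> {} \<and> (\<forall>i\<in>J. below i i) \<and>
     (\<forall>i\<in>J. \<forall>j\<in>J. \<forall>k\<in>J. below i j \<longrightarrow> below j k \<longrightarrow> below i k) \<and>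
     (\<forall>i\<in>J. \<forall>j\<in>J. \<exists>k\<in>J. below i k \<and> below j k)"

definition inner_approximating_net ::
    "('a, 'm) normed_module_scheme \<Rightarrow> ('a, 'y) normed_bimodule \<Rightarrow> ('a \<Rightarrow> 'y) \<Rightarrow>
     'j set \<Rightarrow> ('j \<Rightarrow> 'j \<Rightarrow> bool) \<Rightarrow> ('j \<Rightarrow> 'y) \<Rightarrow> bool" where
  "inner_approximating_net A Y D J below y \<longleftrightarrow> directed_on J below \<and> y \<in> J \<rightarrow> carrier Y \<and>
     (\<forall>a\<in>carrier A. \<forall>e>0. \<exists>i\<in>J. \<forall>j\<in>J. below i j \<longrightarrow>
        \<bar>nrm Y (D a \<ominus>\<^bsub>Y\<^esub> (lact Y a (y j) \<ominus>\<^bsub>Y\<^esub> ract Y (y j) a))\<bar> < e)"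

lemma approximately_inner_net:
  fixes J :: "'j set"
  assumes "inner_approximating_net A Y D J below y"
  shows "approximately_inner A Y D"
proof -
  have dir0: "directed_on J below" using assms by (simp add: inner_approximating_net_def)
  hence "J \<noteq> {}" unfolding directed_on_def by (elim conjE)
  have refl: "below i i" if "i \<in> J" for i
    using dir0 that unfolding directed_on_def by (elim conjE) (rule bspec)
  have trans: "below i k" if "i \<in> J" "j \<in> J" "k \<in> J" "below i j" "below j k" for i j k
  proof -
    have "\<forall>i\<in>J. \<forall>j\<in>J. \<forall>k\<in>J. below i j \<longrightarrow> below j k \<longrightarrow> below i k"
      using dir0 unfolding directed_on_def by (elim conjE)
    with that show ?thesis by blast
  qed
  have dir: "\<exists>k\<in>J. below i k \<and> below j k" if "i \<in> J" "j \<in> J" for i j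
  proof -
    have "\<forall>i\<in>J. \<forall>j\<in>J. \<exists>k\<in>J. below i k \<and> below j k"
      using dir0 unfolding directed_on_def by (elim conjE)
    with that show ?thesis by blast
  qed
  have y: "y \<in> J \<rightarrow> carrier Y" using assms by (simp add: inner_approximating_net_def)
  have lim: "\<exists>i\<in>J. \<forall>j\<in>J. below i j \<longrightarrow>
        \<bar>nrm Y (D a \<ominus>\<^bsub>Y\<^esub> (lact Y a (y j) \<ominus>\<^bsub>Y\<^esub> ract Y (y j) a))\<bar> < e"
    if "a \<in> carrier A" "e > 0" for a e
    using assms that unfolding inner_approximating_net_def by (elim conjE) simp
  define F where "F = (INF i\<in>J. principal (y ` {j\<in>J. below i j}))"
  have ev: "eventually P F \<longleftrightarrow> (\<exists>i\<in>J. \<forall>j\<in>J. below i j \<longrightarrow> P (y j))" for P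
  proof -
    have "eventually P F \<longleftrightarrow> (\<exists>i\<in>J. eventually P (principal (y ` {j\<in>J. below i j})))"
      unfolding F_def
    proof (rule eventually_INF_base)
      show "J \<noteq> {}" by fact
      fix i j assume "i \<in> J" "j \<in> J"
      then obtain k where "k \<in> J" "below i k" "below j k"
        using dir by blast
      moreover have "{l\<in>J. below k l} \<subseteq> {l\<in>J. below i l} \<inter> {l\<in>J. below j l}"
        using trans[OF \<open>i \<in> J\<close> \<open>k \<in> J\<close>] trans[OF \<open>j \<in> J\<close> \<open>k \<in> J\<close>] calculation by auto
      hence "principal (y ` {l\<in>J. below k l})
          \<le> inf (principal (y ` {l\<in>J. below i l})) (principal (y ` {l\<in>J. below j l}))"
        by (simp add: image_mono)
      thus "\<exists>k\<in>J. principal (y ` {l\<in>J. below k l})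
          \<le> inf (principal (y ` {l\<in>J. below i l})) (principal (y ` {l\<in>J. below j l}))"
        using \<open>k \<in> J\<close> by blast
    qed
    thus ?thesis by (auto simp: eventually_principal)
  qed
  have "F \<noteq> bot"
    using ev[of "\<lambda>_. False"] refl by (auto simp: trivial_limit_def)
  moreover have "\<forall>\<^sub>F z in F. z \<in> carrier Y"
    unfolding ev using y \<open>J \<noteq> {}\<close> by auto
  moreover have "((\<lambda>z. nrm Y (D a \<ominus>\<^bsub>Y\<^esub> (lact Y a z \<ominus>\<^bsub>Y\<^esub> ract Y z a))) \<longlongrightarrow> 0) F"
    if "a \<in> carrier A" for a
    unfolding tendsto_iff ev using lim[OF that] by (simp add: dist_real_def)
  ultimately show ?thesis unfolding approximately_inner_def by blast
qed

lemma approximately_inner_imp_net: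
  fixes Y :: "('a, 'y) normed_bimodule"
  assumes "approximately_inner A Y D"
  shows "\<exists>(J :: ('y \<times> 'y set) set) below y. inner_approximating_net A Y D J below y"
proof -
  obtain F where F: "F \<noteq> bot" and FY: "\<forall>\<^sub>F y in F. y \<in> carrier Y"
    and lim: "\<And>a. a \<in> carrier A \<Longrightarrow>
      ((\<lambda>y. nrm Y (D a \<ominus>\<^bsub>Y\<^esub> (lact Y a y \<ominus>\<^bsub>Y\<^esub> ract Y y a))) \<longlongrightarrow> 0) F"
    using assms unfolding approximately_inner_def by blast
  define J where "J = {(y, U). y \<in> U \<and> U \<subseteq> carrier Y \<and> eventually (\<lambda>z. z \<in> U) F}"
  define below :: "'y \<times> 'y set \<Rightarrow> 'y \<times> 'y set \<Rightarrow> bool" where "below p q \<longleftrightarrow> snd q \<subseteq> snd p" for p q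
  have ne: "\<exists>y. (y, U) \<in> J" if "U \<subseteq> carrier Y" "eventually (\<lambda>z. z \<in> U) F" for U
    using that F eventually_happens'[OF F that(2)] by (auto simp: J_def)
  have "directed_on J below"
    unfolding directed_on_def
  proof (intro conjI ballI impI)
    show "J \<noteq> {}" using ne[of "carrier Y"] FY by auto
    fix p q assume "p \<in> J" "q \<in> J"
    hence "snd p \<inter> snd q \<subseteq> carrier Y" "eventually (\<lambda>z. z \<in> snd p \<inter> snd q) F"
      by (auto simp: J_def eventually_conj_iff)
    from ne[OF this] obtain y where "(y, snd p \<inter> snd q) \<in> J" by blast
    thus "\<exists>r\<in>J. below p r \<and> below q r"
      by (intro bexI[of _ "(y, snd p \<inter> snd q)"]) (auto simp: below_def)
  qed (auto simp: below_def)
  moreover have "\<exists>p\<in>J. \<forall>q\<in>J. below p q \<longrightarrow>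
        \<bar>nrm Y (D a \<ominus>\<^bsub>Y\<^esub> (lact Y a (fst q) \<ominus>\<^bsub>Y\<^esub> ract Y (fst q) a))\<bar> < e"
    if "a \<in> carrier A" "e > 0" for a e
  proof -
    define U where "U = {z \<in> carrier Y. \<bar>nrm Y (D a \<ominus>\<^bsub>Y\<^esub> (lact Y a z \<ominus>\<^bsub>Y\<^esub> ract Y z a))\<bar> < e}"
    have "eventually (\<lambda>z. z \<in> U) F"
      using tendstoD[OF lim[OF that(1)] that(2)] FY by (simp add: U_def eventually_conj_iff)
    from ne[OF _ this] obtain z where "(z, U) \<in> J" by (auto simp: U_def)
    thus ?thesis by (intro bexI[of _ "(z, U)"]) (auto simp: below_def U_def J_def)
  qed
  ultimately have "inner_approximating_net A Y D J below fst"
    unfolding inner_approximating_net_def by (auto simp: J_def)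
  thus ?thesis by blast
qed

text \<open>
  HOL cannot quantify over the Banach bimodules of all types, so the type \<open>'x\<close> of their elements
  is a parameter. Any type at least as large as \<open>carrier A\<close> gives the same notion (for \<open>A\<close> nonzero;
  for \<open>A = 0\<close> there is nothing to prove).
  Suppose that \<open>D : A \<rightarrow> X*\<close> is not approximately inner: for some \<open>e > 0\<close> and finite \<open>E \<subseteq> A\<close>, every
  \<open>\<phi> \<in> X*\<close> satisfies \<open>\<parallel>D a - (a \<cdot> \<phi> - \<phi> \<cdot> a)\<parallel> > e\<close> for some \<open>a \<in> E\<close>. Weak-star compactness of the
  balls of \<open>X*\<close> provides countably many \<open>x\<close> in the unit ball of \<open>X\<close> that witness all these
  inequalities. Let \<open>Z\<close> be the closed submodule generated by them; by Hahn-Banach the derivation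
  \<open>a \<mapsto> D a | Z\<close> into \<open>Z*\<close> is not approximately inner either, and \<open>Z\<close> has at most as many
  elements as \<open>A\<close>.
\<close>

definition approximately_amenable :: "'x itself \<Rightarrow> ('a, 'm) normed_module_scheme \<Rightarrow> bool" where
  "approximately_amenable (_ :: 'x itself) A \<longleftrightarrow>
     (\<forall>X :: ('a, 'x) normed_bimodule. banach_bimodule A X \<longrightarrow>
        (\<forall>D. continuous_derivation A (dual_bimodule X) D \<longrightarrow>
             approximately_inner A (dual_bimodule X) D))"


section \<open>Convolution algebras and Brandt semigroups\<close>

text \<open>Semigroups use the HOL-Algebra monoid record, ignoring its field \<open>one\<close>.\<close>

locale semigroup_on =
  fixes S (structure)
  assumes closed: "s \<in> carrier S \<Longrightarrow> t \<in> carrier S \<Longrightarrow> s \<otimes> t \<in> carrier S"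
    and assoc:
      "s \<in> carrier S \<Longrightarrow> t \<in> carrier S \<Longrightarrow> u \<in> carrier S \<Longrightarrow> (s \<otimes> t) \<otimes> u = s \<otimes> (t \<otimes> u)"

definition l1_algebra :: "('s, 'm) monoid_scheme \<Rightarrow> ('s \<Rightarrow> complex) normed_module" where
  "l1_algebra S =
    \<lparr>carrier = {f. (\<lambda>s. cmod (f s)) summable_on carrier S \<and> (\<forall>s. s \<notin> carrier S \<longrightarrow> f s = 0)},
     monoid.mult = (\<lambda>f g u.
       \<Sum>\<^sub>\<infinity>(s, t) \<in> {(s, t). s \<in> carrier S \<and> t \<in> carrier S \<and> s \<otimes>\<^bsub>S\<^esub> t = u}. f s * g t),
     one = undefined,
     zero = (\<lambda>s. 0),
     add = (\<lambda>f g s. f s + g s),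
     smult = (\<lambda>k f s. k * f s),
     nrm = (\<lambda>f. \<Sum>\<^sub>\<infinity>s\<in>carrier S. cmod (f s))\<rparr>"

type_synonym ('i, 'g) brandt = "('i \<times> 'g \<times> 'i) option"

fun brandt_mult :: "('g, 'm) monoid_scheme \<Rightarrow> ('i, 'g) brandt \<Rightarrow> ('i, 'g) brandt \<Rightarrow> ('i, 'g) brandt"
  where
    "brandt_mult G (Some (i, g, j)) (Some (k, h, l)) =
       (if j = k then Some (i, g \<otimes>\<^bsub>G\<^esub> h, l) else None)"
  | "brandt_mult G _ _ = None"

text \<open>The zero \<open>\<theta>\<close> is \<open>None\<close>.\<close>

definition brandt_semigroup :: "('g, 'm) monoid_scheme \<Rightarrow> 'i set \<Rightarrow> ('i, 'g) brandt monoid" where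
  "brandt_semigroup G I =
    \<lparr>carrier = insert None (Some ` (I \<times> carrier G \<times> I)),
     monoid.mult = brandt_mult G,
     one = undefined\<rparr>"

lemma semigroup_brandt:
  assumes "group G"
  shows "semigroup_on (brandt_semigroup G I)"
proof -
  interpret group G by fact
  show ?thesis
  proof
    fix s t assume "s \<in> carrier (brandt_semigroup G I)" "t \<in> carrier (brandt_semigroup G I)"
    thus "s \<otimes>\<^bsub>brandt_semigroup G I\<^esub> t \<in> carrier (brandt_semigroup G I)"
      by (auto simp: brandt_semigroup_def)
  next
    fix s t u
    assume "s \<in> carrier (brandt_semigroup G I)" "t \<in> carrier (brandt_semigroup G I)"
      "u \<in> carrier (brandt_semigroup G I)"
    thus "s \<otimes>\<^bsub>brandt_semigroup G I\<^esub> t \<otimes>\<^bsub>brandt_semigroup G I\<^esub> u =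
          s \<otimes>\<^bsub>brandt_semigroup G I\<^esub> (t \<otimes>\<^bsub>brandt_semigroup G I\<^esub> u)"
      by (auto simp: brandt_semigroup_def m_assoc)
  qed
qed

context semigroup_on
begin

abbreviation "L \<equiv> l1_algebra S"

lemma l1_simps:
  "f \<in> carrier L \<longleftrightarrow> (\<lambda>s. cmod (f s)) summable_on carrier S \<and> (\<forall>s. s \<notin> carrier S \<longrightarrow> f s = 0)"
  "\<zero>\<^bsub>L\<^esub> = (\<lambda>s. 0)" "f \<oplus>\<^bsub>L\<^esub> g = (\<lambda>s. f s + g s)" "k \<odot>\<^bsub>L\<^esub> f = (\<lambda>s. k * f s)"
  "nrm L f = (\<Sum>\<^sub>\<infinity>s\<in>carrier S. cmod (f s))"
  "f \<otimes>\<^bsub>L\<^esub> g = (\<lambda>u. \<Sum>\<^sub>\<infinity>(s, t) \<in> {(s, t). s \<in> carrier S \<and> t \<in> carrier S \<and> s \<otimes> t = u}. f s * g t)"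
  by (simp_all add: l1_algebra_def)

lemma l1_add_closed:
  assumes "f \<in> carrier L" "g \<in> carrier L"
  shows "(\<lambda>s. f s + g s) \<in> carrier L"
proof -
  have "(\<lambda>s. cmod (f s) + cmod (g s)) summable_on carrier S"
    using assms by (intro summable_on_add) (auto simp: l1_simps)
  hence "(\<lambda>s. cmod (f s + g s)) summable_on carrier S"
    by (rule abs_summable_on_comparison_test') (rule norm_triangle_ineq)
  thus ?thesis using assms by (auto simp: l1_simps)
qed

lemma l1_smult_closed:
  assumes "f \<in> carrier L"
  shows "(\<lambda>s. k * f s) \<in> carrier L"
  using assms by (auto simp: l1_simps norm_mult intro: summable_on_cmult_right)

lemma l1_uminus_closed: "f \<in> carrier L \<Longrightarrow> (\<lambda>s. - f s) \<in> carrier L"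
  using l1_smult_closed[of f "-1"] by simp

lemma module_l1: "module complex_ring L"
proof (rule moduleI)
  show "cring complex_ring"
  proof (rule cringI)
    show "abelian_group complex_ring"
    proof (rule abelian_groupI)
      fix x assume "x \<in> carrier complex_ring"
      show "\<exists>y\<in>carrier complex_ring. y \<oplus>\<^bsub>complex_ring\<^esub> x = \<zero>\<^bsub>complex_ring\<^esub>"
        by (intro bexI[of _ "- x"]) (simp_all add: complex_ring_def)
    qed (simp_all add: complex_ring_def)
    show "comm_monoid complex_ring"
      by (rule comm_monoidI) (auto simp: complex_ring_def)
  qed (auto simp: complex_ring_def distrib_right)
  show "abelian_group L"
  proof (rule abelian_groupI)
    fix f assume "f \<in> carrier L"
    thus "\<exists>g\<in>carrier L. g \<oplus>\<^bsub>L\<^esub> f = \<zero>\<^bsub>L\<^esub>"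
      by (intro bexI[of _ "\<lambda>s. - f s"] l1_uminus_closed) (simp_all add: l1_simps(2,3))
  next
    show "\<zero>\<^bsub>L\<^esub> \<in> carrier L" by (simp add: l1_simps)
  qed (use l1_add_closed in \<open>simp_all add: l1_simps(2,3) ac_simps\<close>)
qed (use l1_smult_closed in \<open>simp_all add: l1_simps(2,3,4) complex_ring_def algebra_simps\<close>)

lemma l1_minus:
  assumes "f \<in> carrier L" "g \<in> carrier L"
  shows "f \<ominus>\<^bsub>L\<^esub> g = (\<lambda>s. f s - g s)"
proof -
  interpret module complex_ring L by (rule module_l1)
  have "\<ominus>\<^bsub>L\<^esub> g = (\<lambda>s. - g s)"
    by (rule M.minus_equality) (use assms l1_uminus_closed in \<open>simp_all add: l1_simps(2,3)\<close>)
  thus ?thesis by (simp add: M.minus_eq l1_simps(3))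
qed

lemma l1_complete:
  assumes u: "\<And>n. u n \<in> carrier L"
    and cauchy: "\<And>e. e > 0 \<Longrightarrow> \<exists>N. \<forall>m\<ge>N. \<forall>n\<ge>N. nrm L (u m \<ominus>\<^bsub>L\<^esub> u n) < e"
  shows "\<exists>f\<in>carrier L. (\<lambda>n::nat. nrm L (u n \<ominus>\<^bsub>L\<^esub> f)) \<longlonglongrightarrow> 0"
proof -
  have diff: "(\<lambda>s. u m s - u n s) \<in> carrier L" for m n
    using l1_add_closed[OF u l1_uminus_closed[OF u]] by simp
  have fin: "(\<Sum>s\<in>E. cmod (f s)) \<le> nrm L f" if "finite E" "E \<subseteq> carrier S" "f \<in> carrier L" for E f
    using that unfolding l1_simps by (intro finite_sum_le_infsum) auto
  have c: "\<exists>N. \<forall>m\<ge>N. \<forall>n\<ge>N. nrm L (\<lambda>s. u m s - u n s) < e" if "e > 0" for e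
    using cauchy[OF that] u by (simp add: l1_minus)
  have "Cauchy (\<lambda>n. u n s)" for s
  proof (cases "s \<in> carrier S")
    case True
    have le: "cmod (u m s - u n s) \<le> nrm L (\<lambda>s. u m s - u n s)" for m n
      using fin[of "{s}", OF _ _ diff] True by simp
    show ?thesis unfolding Cauchy_def dist_norm using c le by (meson le_less_trans)
  next
    case False
    thus ?thesis using u by (simp add: l1_simps(1) Cauchy_def)
  qed
  hence "\<exists>l. (\<lambda>n. u n s) \<longlonglongrightarrow> l" for s
    using Cauchy_convergent convergent_def by blast
  then obtain f where f: "\<And>s. (\<lambda>n. u n s) \<longlonglongrightarrow> f s" by metis
  have tail: "\<exists>N. \<forall>n\<ge>N. \<forall>E. finite E \<longrightarrow> E \<subseteq> carrier S \<longrightarrow> (\<Sum>s\<in>E. cmod (u n s - f s)) \<le> e"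
    if "e > 0" for e
  proof -
    obtain N where N: "\<And>m n. m \<ge> N \<Longrightarrow> n \<ge> N \<Longrightarrow> nrm L (\<lambda>s. u m s - u n s) < e"
      using c[OF \<open>e > 0\<close>] by blast
    have "(\<Sum>s\<in>E. cmod (u n s - f s)) \<le> e" if "n \<ge> N" "finite E" "E \<subseteq> carrier S" for n E
    proof (rule tendsto_upperbound)
      show "(\<lambda>m. \<Sum>s\<in>E. cmod (u n s - u m s)) \<longlonglongrightarrow> (\<Sum>s\<in>E. cmod (u n s - f s))"
        by (intro tendsto_intros f)
      have "(\<Sum>s\<in>E. cmod (u n s - u m s)) \<le> e" if "m \<ge> N" for m
        using fin[OF \<open>finite E\<close> \<open>E \<subseteq> carrier S\<close> diff[of n m]] N[OF \<open>n \<ge> N\<close> that] by linarith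
      thus "\<forall>\<^sub>F m in sequentially. (\<Sum>s\<in>E. cmod (u n s - u m s)) \<le> e"
        unfolding eventually_sequentially by blast
    qed simp
    thus ?thesis by blast
  qed
  have f0: "f s = 0" if "s \<notin> carrier S" for s
    using f[of s] u that by (simp add: l1_simps(1) LIMSEQ_const_iff)
  have dL: "(\<lambda>s. u n s - f s) \<in> carrier L" if "\<And>E. finite E \<Longrightarrow> E \<subseteq> carrier S \<Longrightarrow>
      (\<Sum>s\<in>E. cmod (u n s - f s)) \<le> e" for n e
    unfolding l1_simps
  proof (intro conjI allI impI)
    show "(\<lambda>s. cmod (u n s - f s)) summable_on carrier S"
      by (rule nonneg_bdd_above_summable_on) (use that in \<open>auto intro!: bdd_aboveI2[of _ _ e]\<close>)
    show "u n s - f s = 0" if "s \<notin> carrier S" for s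
      using u f0 that by (simp add: l1_simps(1))
  qed
  obtain n e where "(\<lambda>s. u n s - f s) \<in> carrier L"
    using tail[of 1] dL by (metis le_refl zero_less_one)
  from l1_add_closed[OF u[of n] l1_uminus_closed[OF this]] have fL: "f \<in> carrier L" by simp
  have "\<exists>N. \<forall>n\<ge>N. nrm L (\<lambda>s. u n s - f s) \<le> e" if e: "e > 0" for e
  proof -
    obtain N where N: "\<And>n E. n \<ge> N \<Longrightarrow> finite E \<Longrightarrow> E \<subseteq> carrier S \<Longrightarrow>
        (\<Sum>s\<in>E. cmod (u n s - f s)) \<le> e"
      using tail[OF e] by blast
    have "nrm L (\<lambda>s. u n s - f s) \<le> e" if "n \<ge> N" for n
      using dL[OF N[OF that]] N[OF that]
      unfolding l1_simps by (intro infsum_le_finite_sums) auto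
    thus ?thesis by blast
  qed
  hence "\<exists>N. \<forall>n\<ge>N. nrm L (\<lambda>s. u n s - f s) < e" if "e > 0" for e
    using that by (meson dense le_less_trans)
  moreover have "nrm L g \<ge> 0" for g by (simp add: l1_simps infsum_nonneg)
  ultimately have "(\<lambda>n. nrm L (\<lambda>s. u n s - f s)) \<longlonglongrightarrow> 0"
    by (simp add: LIMSEQ_def)
  thus ?thesis using fL u by (auto simp: l1_minus)
qed

lemma banach_space_l1: "complex_banach_space L"
proof -
  interpret module complex_ring L by (rule module_l1)
  show ?thesis
  proof
    fix f assume f: "f \<in> carrier L"
    show "nrm L f = 0 \<longleftrightarrow> f = \<zero>\<^bsub>L\<^esub>"
    proof
      assume "nrm L f = 0"
      hence "cmod (f s) = 0" if "s \<in> carrier S" for s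
        using nonneg_infsum_le_0D[of "\<lambda>s. cmod (f s)" "carrier S" s] f that
        by (simp add: l1_simps)
      thus "f = \<zero>\<^bsub>L\<^esub>" using f by (auto simp: l1_simps fun_eq_iff)
    qed (simp add: l1_simps)
    show "nrm L (k \<odot>\<^bsub>L\<^esub> f) = cmod k * nrm L f" for k
      by (simp add: l1_simps norm_mult infsum_cmult_right')
  next
    fix f g assume fg: "f \<in> carrier L" "g \<in> carrier L"
    have "nrm L (\<lambda>s. f s + g s) \<le> (\<Sum>\<^sub>\<infinity>s\<in>carrier S. cmod (f s) + cmod (g s))"
      using fg l1_add_closed[OF fg] unfolding l1_simps
      by (intro infsum_mono summable_on_add norm_triangle_ineq) auto
    also have "\<dots> = nrm L f + nrm L g"
      using fg unfolding l1_simps by (intro infsum_add) auto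
    finally show "nrm L (f \<oplus>\<^bsub>L\<^esub> g) \<le> nrm L f + nrm L g" by (simp add: l1_simps(3))
  qed (rule l1_complete)
qed

text \<open>The following three facts reduce convolution to sums over products of copies of \<open>S\<close>.\<close>

definition fib :: "'a \<Rightarrow> ('a \<times> 'a) set" where
  "fib u = {(s, t). s \<in> carrier S \<and> t \<in> carrier S \<and> s \<otimes> t = u}"

lemma l1_mult: "f \<otimes>\<^bsub>L\<^esub> g = (\<lambda>u. \<Sum>\<^sub>\<infinity>(s, t) \<in> fib u. f s * g t)"
  by (simp add: l1_simps fib_def)

lemma bij_fib: "bij_betw snd (Sigma (carrier S) fib) (carrier S \<times> carrier S)"
  by (rule bij_betwI[where g = "\<lambda>(s, t). (s \<otimes> t, s, t)"]) (auto simp: fib_def closed)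

lemma l1_prod_summable:
  assumes "f \<in> carrier L" "g \<in> carrier L"
  shows "(\<lambda>(s, t). f s * g t) abs_summable_on (carrier S \<times> carrier S)"
    and "(\<Sum>\<^sub>\<infinity>(s, t)\<in>carrier S \<times> carrier S. cmod (f s * g t)) = nrm L f * nrm L g"
proof -
  have f: "(\<lambda>s. cmod (f s)) summable_on carrier S" and g: "(\<lambda>s. cmod (g s)) summable_on carrier S"
    using assms by (simp_all add: l1_simps)
  show *: "(\<lambda>(s, t). f s * g t) abs_summable_on (carrier S \<times> carrier S)"
    unfolding abs_summable_on_Sigma_iff
    using f g by (auto simp: norm_mult infsum_cmult_right' abs_mult
        intro!: summable_on_cmult_right summable_on_cmult_left)
  have "(\<lambda>p. cmod (case p of (s, t) \<Rightarrow> f s * g t)) summable_on (carrier S \<times> carrier S)"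
    using * by simp
  from infsum_Sigma_banach[OF this]
  show "(\<Sum>\<^sub>\<infinity>(s, t)\<in>carrier S \<times> carrier S. cmod (f s * g t)) = nrm L f * nrm L g"
    by (simp add: l1_simps norm_mult infsum_cmult_right' infsum_cmult_left' case_prod_unfold)
qed

lemma l1_fib_summable:
  assumes "f \<in> carrier L" "g \<in> carrier L"
  shows "(\<lambda>(s, t). f s * g t) abs_summable_on fib u"
  using l1_prod_summable(1)[OF assms]
  by (rule summable_on_subset_banach) (auto simp: fib_def)

lemma l1_mult_closed_norm:
  assumes f: "f \<in> carrier L" and g: "g \<in> carrier L"
  shows "f \<otimes>\<^bsub>L\<^esub> g \<in> carrier L" and "nrm L (f \<otimes>\<^bsub>L\<^esub> g) \<le> nrm L f * nrm L g"
proof -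
  define c where "c p = cmod (case p of (s, t) \<Rightarrow> f s * g t)" for p
  have "c summable_on carrier S \<times> carrier S"
    using l1_prod_summable(1)[OF f g] unfolding c_def .
  hence sig: "(\<lambda>q. c (snd q)) summable_on Sigma (carrier S) fib"
    using summable_on_reindex_bij_betw[OF bij_fib, of c] by simp
  have le: "cmod ((f \<otimes>\<^bsub>L\<^esub> g) u) \<le> infsum c (fib u)" for u
    unfolding l1_mult c_def by (rule norm_infsum_bound) (rule l1_fib_summable[OF f g])
  have sum: "(\<lambda>u. infsum c (fib u)) summable_on carrier S"
    using summable_on_Sigma_banach[of "\<lambda>u p. c p" "carrier S" fib] sig by (simp add: case_prod_unfold)
  have abs: "(\<lambda>u. cmod ((f \<otimes>\<^bsub>L\<^esub> g) u)) summable_on carrier S"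
    by (rule abs_summable_on_comparison_test'[OF sum le])
  have "fib u = {}" if "u \<notin> carrier S" for u
    using that closed by (auto simp: fib_def)
  hence "(f \<otimes>\<^bsub>L\<^esub> g) u = 0" if "u \<notin> carrier S" for u
    using that by (simp add: l1_mult)
  with abs show "f \<otimes>\<^bsub>L\<^esub> g \<in> carrier L" by (simp add: l1_simps(1))
  have "nrm L (f \<otimes>\<^bsub>L\<^esub> g) \<le> (\<Sum>\<^sub>\<infinity>u\<in>carrier S. infsum c (fib u))"
    unfolding l1_simps(5) by (intro infsum_mono abs sum le)
  also have "\<dots> = infsum c (carrier S \<times> carrier S)"
    using infsum_Sigma_banach[OF sig] infsum_reindex_bij_betw[OF bij_fib, of c] by simp
  also have "\<dots> = nrm L f * nrm L g"
    using l1_prod_summable(2)[OF f g] by (simp add: c_def[abs_def] case_prod_unfold)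
  finally show "nrm L (f \<otimes>\<^bsub>L\<^esub> g) \<le> nrm L f * nrm L g" .
qed

lemma l1_mult_assoc:
  assumes f: "f \<in> carrier L" and g: "g \<in> carrier L" and h: "h \<in> carrier L"
  shows "(f \<otimes>\<^bsub>L\<^esub> g) \<otimes>\<^bsub>L\<^esub> h = f \<otimes>\<^bsub>L\<^esub> (g \<otimes>\<^bsub>L\<^esub> h)"
proof
  fix u
  define T where "T = {(s, t, r). s \<in> carrier S \<and> t \<in> carrier S \<and> r \<in> carrier S \<and> s \<otimes> t \<otimes> r = u}"
  define F where "F = (\<lambda>(s, t, r). f s * g t * h r)"
  have "F abs_summable_on carrier S \<times> carrier S \<times> carrier S"
  proof (rule abs_summable_on_Sigma_iff[THEN iffD2], intro conjI ballI)
    fix s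
    have eq: "cmod (F (s, p)) = cmod (f s) * cmod (case p of (t, r) \<Rightarrow> g t * h r)" for p
      by (simp add: F_def norm_mult mult.assoc case_prod_unfold)
    show "(\<lambda>p. F (s, p)) abs_summable_on carrier S \<times> carrier S"
      unfolding eq by (intro summable_on_cmult_right l1_prod_summable g h)
  next
    have eq: "(\<Sum>\<^sub>\<infinity>p\<in>carrier S \<times> carrier S. cmod (F (s, p))) = cmod (f s) * (nrm L g * nrm L h)" for s
    proof -
      have "cmod (F (s, p)) = cmod (f s) * (case p of (t, r) \<Rightarrow> cmod (g t * h r))" for p
        by (simp add: F_def norm_mult mult.assoc case_prod_unfold)
      thus ?thesis by (simp add: infsum_cmult_right' l1_prod_summable(2)[OF g h])
    qed
    have "(\<lambda>s. cmod (f s) * (nrm L g * nrm L h)) summable_on carrier S"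
      using f by (intro summable_on_cmult_left) (simp add: l1_simps(1))
    thus "(\<lambda>s. \<Sum>\<^sub>\<infinity>p\<in>carrier S \<times> carrier S. cmod (F (s, p))) abs_summable_on carrier S"
      unfolding eq by (rule summable_on_iff_abs_summable_on_real[THEN iffD1])
  qed
  hence "F abs_summable_on T"
    by (rule summable_on_subset_banach) (auto simp: T_def)
  hence FT: "F summable_on T" by (rule abs_summable_summable)
  have bij1: "bij_betw (\<lambda>((p, r), (s, t)). (s, t, r)) (Sigma (fib u) (\<lambda>(p, r). fib p)) T"
    by (rule bij_betwI[where g = "\<lambda>(s, t, r). ((s \<otimes> t, r), (s, t))"])
      (auto simp: fib_def T_def closed)
  have bij2: "bij_betw (\<lambda>((s, q), (t, r)). (s, t, r)) (Sigma (fib u) (\<lambda>(s, q). fib q)) T"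
    by (rule bij_betwI[where g = "\<lambda>(s, t, r). ((s, t \<otimes> r), (t, r))"])
      (auto simp: fib_def T_def closed assoc)
  have "((f \<otimes>\<^bsub>L\<^esub> g) \<otimes>\<^bsub>L\<^esub> h) u = (\<Sum>\<^sub>\<infinity>(p, r)\<in>fib u. \<Sum>\<^sub>\<infinity>(s, t)\<in>fib p. F (s, t, r))"
    unfolding l1_mult F_def
    by (simp add: infsum_cmult_left'[symmetric] case_prod_unfold)
  also have "\<dots> = infsum F T"
    using infsum_Sigma_banach[OF summable_on_reindex_bij_betw[OF bij1, of F, THEN iffD2, OF FT]]
      infsum_reindex_bij_betw[OF bij1, of F] by (simp add: case_prod_unfold)
  also have "\<dots> = (\<Sum>\<^sub>\<infinity>(s, q)\<in>fib u. \<Sum>\<^sub>\<infinity>(t, r)\<in>fib q. F (s, t, r))"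
    using infsum_Sigma_banach[OF summable_on_reindex_bij_betw[OF bij2, of F, THEN iffD2, OF FT]]
      infsum_reindex_bij_betw[OF bij2, of F] by (simp add: case_prod_unfold)
  also have "\<dots> = (f \<otimes>\<^bsub>L\<^esub> (g \<otimes>\<^bsub>L\<^esub> h)) u"
    unfolding l1_mult F_def
    by (simp add: infsum_cmult_right'[symmetric] case_prod_unfold mult.assoc)
  finally show "((f \<otimes>\<^bsub>L\<^esub> g) \<otimes>\<^bsub>L\<^esub> h) u = (f \<otimes>\<^bsub>L\<^esub> (g \<otimes>\<^bsub>L\<^esub> h)) u" .
qed

theorem banach_algebra_l1: "banach_algebra L"
proof -
  interpret complex_banach_space L by (rule banach_space_l1)
  have summ: "(\<lambda>p. f (fst p) * g (snd p)) summable_on fib u"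
    if "f \<in> carrier L" "g \<in> carrier L" for f g u
    using abs_summable_summable[OF l1_fib_summable[OF that]] by (simp add: case_prod_unfold)
  show ?thesis
  proof
    fix f g h assume "f \<in> carrier L" "g \<in> carrier L" "h \<in> carrier L"
    thus "(f \<oplus>\<^bsub>L\<^esub> g) \<otimes>\<^bsub>L\<^esub> h = (f \<otimes>\<^bsub>L\<^esub> h) \<oplus>\<^bsub>L\<^esub> (g \<otimes>\<^bsub>L\<^esub> h)"
      "f \<otimes>\<^bsub>L\<^esub> (g \<oplus>\<^bsub>L\<^esub> h) = (f \<otimes>\<^bsub>L\<^esub> g) \<oplus>\<^bsub>L\<^esub> (f \<otimes>\<^bsub>L\<^esub> h)"
      by (simp_all add: l1_mult l1_simps(3) case_prod_unfold algebra_simps infsum_add summ)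
  next
    fix f g k
    show "(k \<odot>\<^bsub>L\<^esub> f) \<otimes>\<^bsub>L\<^esub> g = k \<odot>\<^bsub>L\<^esub> (f \<otimes>\<^bsub>L\<^esub> g)"
      by (simp add: l1_mult l1_simps(4) case_prod_unfold mult.assoc infsum_cmult_right')
    show "f \<otimes>\<^bsub>L\<^esub> (k \<odot>\<^bsub>L\<^esub> g) = k \<odot>\<^bsub>L\<^esub> (f \<otimes>\<^bsub>L\<^esub> g)"
      by (simp add: l1_mult l1_simps(4) case_prod_unfold mult.left_commute infsum_cmult_right')
  qed (rule l1_mult_closed_norm l1_mult_assoc; assumption)+
qed

definition delta :: "'a \<Rightarrow> 'a \<Rightarrow> complex" where
  "delta s x = (if x = s then 1 else 0)"

lemma l1_mult_delta:
  assumes "s \<in> carrier S" "t \<in> carrier S"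
  shows "delta s \<otimes>\<^bsub>L\<^esub> delta t = delta (s \<otimes> t)"
proof
  fix u
  have "(delta s \<otimes>\<^bsub>L\<^esub> delta t) u = (\<Sum>\<^sub>\<infinity>p \<in> (if s \<otimes> t = u then {(s, t)} else {}). 1)"
    unfolding l1_mult using assms
    by (intro infsum_cong_neutral) (auto simp: fib_def delta_def split: if_splits)
  thus "(delta s \<otimes>\<^bsub>L\<^esub> delta t) u = delta (s \<otimes> t) u" by (simp add: delta_def)
qed

end

corollary banach_algebra_l1_brandt:
  "group G \<Longrightarrow> banach_algebra (l1_algebra (brandt_semigroup G I))"
  by (rule semigroup_on.banach_algebra_l1) (rule semigroup_brandt)

text \<open>Adjoining an identity to \<open>S\<close> and to \<open>\<ell>\<^sup>1(S)\<close> turns \<open>S\<close> into a subset of \<open>'s option\<close>, and the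
  projective tensor square of the unitisation becomes \<open>\<ell>\<^sup>1\<close> of a subset of
  \<open>'s option \<times> 's option\<close>. The type below holds the duals of all its closed subspaces. It is larger
  than \<open>\<ell>\<^sup>1(S)\<close>, hence large enough to test approximate amenability.\<close>

type_synonym 's bimodule_universe = "('s option \<times> 's option \<Rightarrow> complex) \<Rightarrow> complex"

end

theory Submission
  imports Defs
begin

text \<open>
  Let \<open>J\<close> be the \<open>I \<times> I\<close> matrix all of whose entries are 1. A matrix \<open>a \<in> \<ell>\<^sup>1(I \<times> I)\<close> has a commutator
  \<open>a J - J a\<close> of the form \<open>r \<otimes> 1 - 1 \<otimes> c\<close> with \<open>r, c \<in> \<ell>\<^sup>1(I)\<close>, whereas \<open>J = 1 \<otimes> 1\<close> is not in
  \<open>Y = \<ell>\<^sup>1(I \<times> I) + \<ell>\<^sup>1(I) \<otimes> 1 + 1 \<otimes> \<ell>\<^sup>1(I)\<close>, that is, in \<open>\<ell>\<^sup>1(K)\<close> for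
  \<open>K = (I \<union> {\<infinity>})\<^sup>2 - {(\<infinity>, \<infinity>)}\<close>. This gives a derivation into the dual of \<open>X = \<ell>\<^sup>\<infinity>(K)\<close>, on which
  \<open>\<ell>\<^sup>1(S)\<close> acts through forgetting \<open>G\<close>.

  Choose disjoint blocks \<open>B\<^sub>k \<subseteq> I\<close> of size \<open>4\<^sup>k\<close>, and let \<open>a\<close> and \<open>b\<close> be the diagonal matrices with
  entries \<open>8\<^sup>-\<^sup>k\<close> on the blocks with \<open>k\<close> even, respectively odd. Suppose that \<open>\<phi> \<in> X*\<close> induces the
  derivation up to \<open>\<epsilon>\<close> at \<open>a\<close> and \<open>b\<close>, and let \<open>Z\<^sub>k = 4\<^sup>-\<^sup>k \<phi>(1\<^bsub>B\<^sub>k \<times> {\<infinity>}\<^esub>)\<close> for even \<open>k\<close>,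
  \<open>Z\<^sub>k = 4\<^sup>-\<^sup>k \<phi>(1\<^bsub>{\<infinity>} \<times> B\<^sub>k\<^esub>)\<close> for odd \<open>k\<close>. Testing at \<open>B\<^sub>0 \<times> {\<infinity>}\<close> gives \<open>Z\<^sub>0 \<approx> 1\<close>. For \<open>m\<close> even and
  \<open>n\<close> odd, testing \<open>a\<close> and \<open>b\<close> at the indicator function of \<open>B\<^sub>m \<times> B\<^sub>n\<close> and eliminating the value of
  \<open>\<phi>\<close> there gives \<open>\<bar>Z\<^sub>m - Z\<^sub>n\<bar> \<le> \<epsilon> (8\<^sup>m + 8\<^sup>n) / 4\<^sup>m\<^sup>+\<^sup>n\<close>. For neighbours this is summable, so all \<open>Z\<^sub>k\<close>
  stay near 1, but \<open>\<bar>Z\<^sub>k\<bar> \<le> 4\<^sup>-\<^sup>k \<parallel>\<phi>\<parallel>\<close>.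
\<close>

section \<open>Pairing summable with bounded functions\<close>

context semigroup_on
begin

text \<open>The duality between \<open>\<ell>\<^sup>1(S)\<close> and bounded functions on
  \<open>S\<close>. Both module actions and the derivation below are written with it, so their laws
  reduce to linearity, \<open>pair_swap\<close> and \<open>pair_mult\<close>.\<close>

definition pair :: "('a \<Rightarrow> complex) \<Rightarrow> ('a \<Rightarrow> complex) \<Rightarrow> complex" where
  "pair f h = (\<Sum>\<^sub>\<infinity>s\<in>carrier S. f s * h s)"

lemma pair_cong: "(\<And>s. s \<in> carrier S \<Longrightarrow> h s = h' s) \<Longrightarrow> pair f h = pair f h'"
  unfolding pair_def by (rule infsum_cong) simp

lemma pair_abs_summable:
  assumes "f \<in> carrier L" and "\<And>s. s \<in> carrier S \<Longrightarrow> cmod (h s) \<le> C"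
  shows "(\<lambda>s. f s * h s) abs_summable_on carrier S"
proof (rule abs_summable_on_comparison_test)
  show "(\<lambda>s. f s * complex_of_real C) abs_summable_on carrier S"
    using assms(1) by (auto simp: l1_simps norm_mult intro: summable_on_cmult_left)
  show "cmod (f s * h s) \<le> cmod (f s * complex_of_real C)" if "s \<in> carrier S" for s
    using assms(2)[OF that] norm_ge_zero[of "h s"] by (auto simp: norm_mult intro: mult_left_mono)
qed

lemmas pair_summable = abs_summable_summable[OF pair_abs_summable]

lemma pair_bound:
  assumes f: "f \<in> carrier L" and h: "\<And>s. s \<in> carrier S \<Longrightarrow> cmod (h s) \<le> C"
  shows "cmod (pair f h) \<le> C * nrm L f"
proof -
  have "cmod (pair f h) \<le> (\<Sum>\<^sub>\<infinity>s\<in>carrier S. cmod (f s * h s))"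
    unfolding pair_def by (rule norm_infsum_bound) (rule pair_abs_summable[OF f h])
  also have "\<dots> \<le> (\<Sum>\<^sub>\<infinity>s\<in>carrier S. C * cmod (f s))"
  proof (rule infsum_mono)
    show "(\<lambda>s. C * cmod (f s)) summable_on carrier S"
      using f by (auto simp: l1_simps intro: summable_on_cmult_right)
    show "cmod (f s * h s) \<le> C * cmod (f s)" if "s \<in> carrier S" for s
      using mult_right_mono[OF h[OF that], of "cmod (f s)"] by (simp add: norm_mult mult.commute)
  qed (rule pair_abs_summable[OF f h])
  finally show ?thesis by (simp add: l1_simps infsum_cmult_right')
qed

lemma pair_add_left:
  assumes "f \<in> carrier L" "g \<in> carrier L" "\<And>s. s \<in> carrier S \<Longrightarrow> cmod (h s) \<le> C"
  shows "pair (\<lambda>s. f s + g s) h = pair f h + pair g h"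
  unfolding pair_def distrib_right using assms by (intro infsum_add pair_summable)

lemma pair_add_right:
  assumes "f \<in> carrier L" "\<And>s. s \<in> carrier S \<Longrightarrow> cmod (h s) \<le> C"
    "\<And>s. s \<in> carrier S \<Longrightarrow> cmod (k s) \<le> C'"
  shows "pair f (\<lambda>s. h s + k s) = pair f h + pair f k"
  unfolding pair_def distrib_left
  by (intro infsum_add pair_summable[where C = C] pair_summable[where C = C'] assms)

lemma pair_smult_left: "pair (\<lambda>s. c * f s) h = c * pair f h"
  unfolding pair_def by (simp add: mult.assoc infsum_cmult_right')

lemma pair_smult_right: "pair f (\<lambda>s. c * h s) = c * pair f h"
  unfolding pair_def by (simp add: mult.left_commute infsum_cmult_right')

lemma pair_diff_right:
  assumes "f \<in> carrier L" "\<And>s. s \<in> carrier S \<Longrightarrow> cmod (h s) \<le> C"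
    "\<And>s. s \<in> carrier S \<Longrightarrow> cmod (k s) \<le> C'"
  shows "pair f (\<lambda>s. h s - k s) = pair f h - pair f k"
proof -
  have "pair f (\<lambda>s. h s + - 1 * k s) = pair f h + pair f (\<lambda>s. - 1 * k s)"
    by (rule pair_add_right[OF assms(1), where C = C and C' = C']) (use assms in auto)
  thus ?thesis unfolding pair_smult_right by simp
qed

lemma pair_zero: "pair f (\<lambda>s. 0) = 0"
  by (simp add: pair_def)

text \<open>Domination by \<open>C\<close> times the absolutely summable product of \<open>f\<close>
  and \<open>g\<close>. This justifies regrouping and exchanging the double sums below.\<close>

lemma prod_weighted_summable:
  assumes f: "f \<in> carrier L" and g: "g \<in> carrier L"
    and h: "\<And>s t. s \<in> carrier S \<Longrightarrow> t \<in> carrier S \<Longrightarrow> cmod (h s t) \<le> C"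
  shows "(\<lambda>(s, t). f s * g t * h s t) summable_on (carrier S \<times> carrier S)"
proof (rule abs_summable_summable, rule abs_summable_on_comparison_test')
  show "(\<lambda>p. C * cmod (case p of (s, t) \<Rightarrow> f s * g t)) summable_on (carrier S \<times> carrier S)"
    by (rule summable_on_cmult_right) (rule l1_prod_summable(1)[OF f g])
  fix p assume "p \<in> carrier S \<times> carrier S"
  hence "cmod (h (fst p) (snd p)) \<le> C" using h by auto
  from mult_right_mono[OF this, of "cmod (f (fst p) * g (snd p))"]
  show "cmod (case p of (s, t) \<Rightarrow> f s * g t * h s t) \<le> C * cmod (case p of (s, t) \<Rightarrow> f s * g t)"
    by (simp add: case_prod_unfold norm_mult mult.commute)
qed

lemma pair_pair:
  assumes "f \<in> carrier L" and "g \<in> carrier L"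
    and "\<And>s t. s \<in> carrier S \<Longrightarrow> t \<in> carrier S \<Longrightarrow> cmod (h s t) \<le> C"
  shows "pair f (\<lambda>s. pair g (\<lambda>t. h s t))
    = (\<Sum>\<^sub>\<infinity>(s, t)\<in>carrier S \<times> carrier S. f s * g t * h s t)"
  using infsum_Sigma'_banach[OF prod_weighted_summable[OF assms]]
  by (simp add: pair_def infsum_cmult_right'[symmetric] mult.assoc)

lemma pair_swap:
  assumes "f \<in> carrier L" and "g \<in> carrier L"
    and "\<And>s t. s \<in> carrier S \<Longrightarrow> t \<in> carrier S \<Longrightarrow> cmod (h s t) \<le> C"
  shows "pair f (\<lambda>s. pair g (\<lambda>t. h s t)) = pair g (\<lambda>t. pair f (\<lambda>s. h s t))"
  using infsum_swap_banach[OF prod_weighted_summable[OF assms]]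
  by (simp add: pair_def infsum_cmult_right'[symmetric] mult.assoc mult.left_commute)

text \<open>Convolution collects the pairs \<open>(s, t)\<close> by their product, and
  \<open>h (s \<otimes> t)\<close> is constant on each fibre of the multiplication, so the double
  sum can be regrouped by fibres.\<close>

lemma pair_mult:
  assumes f: "f \<in> carrier L" and g: "g \<in> carrier L"
    and h: "\<And>s. s \<in> carrier S \<Longrightarrow> cmod (h s) \<le> C"
  shows "pair (f \<otimes>\<^bsub>L\<^esub> g) h = pair f (\<lambda>s. pair g (\<lambda>t. h (s \<otimes> t)))"
proof -
  define F where "F = (\<lambda>(s, t). f s * g t * h (s \<otimes> t))"
  have sum: "F summable_on (carrier S \<times> carrier S)"
    unfolding F_def using f g h by (intro prod_weighted_summable) (auto intro: closed)
  hence sum': "(\<lambda>q. F (snd q)) summable_on Sigma (carrier S) fib"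
    using summable_on_reindex_bij_betw[OF bij_fib, of F] by simp
  have "pair (f \<otimes>\<^bsub>L\<^esub> g) h = (\<Sum>\<^sub>\<infinity>u\<in>carrier S. \<Sum>\<^sub>\<infinity>p\<in>fib u. F p)"
    unfolding pair_def l1_mult infsum_cmult_left'[symmetric]
    by (intro infsum_cong) (auto simp: F_def fib_def)
  also have "\<dots> = infsum F (carrier S \<times> carrier S)"
    using infsum_Sigma_banach[OF sum'] infsum_reindex_bij_betw[OF bij_fib, of F] by simp
  also have "\<dots> = pair f (\<lambda>s. pair g (\<lambda>t. h (s \<otimes> t)))"
    unfolding F_def by (rule pair_pair[symmetric, OF f g]) (auto intro: closed h)
  finally show ?thesis .
qed

end


section \<open>Dual bimodules\<close>

lemma dual_simps:
  "\<phi> \<in> carrier (dual_bimodule X) \<longleftrightarrow> bounded_functional X \<phi>"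
  "\<phi> \<oplus>\<^bsub>dual_bimodule X\<^esub> \<psi> = (\<lambda>x. \<phi> x + \<psi> x)"
  "\<zero>\<^bsub>dual_bimodule X\<^esub> = (\<lambda>x. 0)"
  "k \<odot>\<^bsub>dual_bimodule X\<^esub> \<phi> = (\<lambda>x. k * \<phi> x)"
  "lact (dual_bimodule X) a \<phi> = (\<lambda>x. if x \<in> carrier X then \<phi> (ract X x a) else 0)"
  "ract (dual_bimodule X) \<phi> a = (\<lambda>x. if x \<in> carrier X then \<phi> (lact X a x) else 0)"
  "nrm (dual_bimodule X) \<phi> = (SUP x \<in> {x \<in> carrier X. nrm X x \<le> 1}. cmod (\<phi> x))"
  by (simp_all add: dual_bimodule_def)

context complex_banach_space
begin

lemma nrm_zero: "\<nu> \<zero> = 0"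
  using nrm_eq_0 by simp

lemma nrm_nonneg: "x \<in> carrier X \<Longrightarrow> 0 \<le> \<nu> x"
proof -
  assume x: "x \<in> carrier X"
  have "\<zero> = x \<oplus> (- 1) \<odot> x"
    using smult_l_distr[of 1 "- 1" x] smult_one[of x] smult_l_null[of x] x
    by (simp add: complex_ring_def)
  moreover have "(- 1) \<odot> x \<in> carrier X"
    using smult_closed[of "- 1" x] x by (simp add: complex_ring_def)
  ultimately show "0 \<le> \<nu> x"
    using nrm_triangle[of x "(- 1) \<odot> x"] nrm_smult[of x "- 1"] nrm_zero x by simp
qed

end

context
  fixes X :: "('a, 'x) normed_bimodule"
begin

lemma bounded_functional_linear_combination:
  assumes "bounded_functional X \<phi>" "bounded_functional X \<psi>"
  shows "bounded_functional X (\<lambda>x. c * \<phi> x + d * \<psi> x)"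
proof -
  obtain C C' where C: "\<forall>x\<in>carrier X. cmod (\<phi> x) \<le> C * nrm X x"
    and C': "\<forall>x\<in>carrier X. cmod (\<psi> x) \<le> C' * nrm X x"
    using assms unfolding bounded_functional_def by auto
  have "cmod (c * \<phi> x + d * \<psi> x) \<le> (cmod c * C + cmod d * C') * nrm X x" if "x \<in> carrier X" for x
  proof -
    have "cmod (c * \<phi> x + d * \<psi> x) \<le> cmod c * cmod (\<phi> x) + cmod d * cmod (\<psi> x)"
      using norm_triangle_ineq[of "c * \<phi> x" "d * \<psi> x"] by (simp add: norm_mult)
    also have "\<dots> \<le> cmod c * (C * nrm X x) + cmod d * (C' * nrm X x)"
      using C C' that by (intro add_mono mult_left_mono) auto
    finally show ?thesis by (simp add: algebra_simps)
  qed
  hence "\<exists>C. \<forall>x\<in>carrier X. cmod (c * \<phi> x + d * \<psi> x) \<le> C * nrm X x" by blast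
  thus ?thesis
    using assms unfolding bounded_functional_def by (simp add: algebra_simps)
qed

lemma abelian_group_dual: "abelian_group (dual_bimodule X)"
proof (rule abelian_groupI)
  show "\<phi> \<oplus>\<^bsub>dual_bimodule X\<^esub> \<psi> \<in> carrier (dual_bimodule X)"
    if "\<phi> \<in> carrier (dual_bimodule X)" "\<psi> \<in> carrier (dual_bimodule X)" for \<phi> \<psi>
    using bounded_functional_linear_combination[of \<phi> \<psi> 1 1] that by (simp add: dual_simps)
  show "\<zero>\<^bsub>dual_bimodule X\<^esub> \<in> carrier (dual_bimodule X)"
    by (auto simp: dual_simps bounded_functional_def intro: exI[of _ 0])
  show "\<exists>\<psi>\<in>carrier (dual_bimodule X). \<psi> \<oplus>\<^bsub>dual_bimodule X\<^esub> \<phi> = \<zero>\<^bsub>dual_bimodule X\<^esub>"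
    if "\<phi> \<in> carrier (dual_bimodule X)" for \<phi>
    using bounded_functional_linear_combination[of \<phi> \<phi> "-1" 0] that
    by (intro bexI[of _ "\<lambda>x. - \<phi> x"]) (simp_all add: dual_simps)
qed (simp_all add: dual_simps ac_simps)

lemma dual_minus:
  assumes "\<phi> \<in> carrier (dual_bimodule X)" "\<psi> \<in> carrier (dual_bimodule X)"
  shows "\<phi> \<ominus>\<^bsub>dual_bimodule X\<^esub> \<psi> = (\<lambda>x. \<phi> x - \<psi> x)"
proof -
  interpret abelian_group "dual_bimodule X" by (rule abelian_group_dual)
  have "\<ominus>\<^bsub>dual_bimodule X\<^esub> \<psi> = (\<lambda>x. - \<psi> x)"
    using assms bounded_functional_linear_combination[of \<psi> \<psi> "-1" 0]
    by (intro minus_equality) (simp_all add: dual_simps)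
  thus ?thesis by (simp add: minus_eq dual_simps)
qed

lemma dual_norm_bound:
  assumes "complex_banach_space X"
    and \<phi>: "\<phi> \<in> carrier (dual_bimodule X)" and x: "x \<in> carrier X" "nrm X x \<le> 1"
  shows "cmod (\<phi> x) \<le> nrm (dual_bimodule X) \<phi>"
  unfolding dual_simps
proof (rule cSUP_upper)
  obtain C where C: "\<forall>x\<in>carrier X. cmod (\<phi> x) \<le> C * nrm X x"
    using \<phi> unfolding dual_simps bounded_functional_def by blast
  \<comment> \<open>Nothing forces \<open>C\<close> to be nonnegative, since the space may be zero;
    hence the absolute value.\<close>
  have "cmod (\<phi> x) \<le> \<bar>C\<bar>" if "x \<in> carrier X" "nrm X x \<le> 1" for x
  proof -
    have "0 \<le> nrm X x"
      using assms(1) that(1) by (rule complex_banach_space.nrm_nonneg)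
    hence "C * nrm X x \<le> \<bar>C\<bar> * 1"
      using that by (intro mult_mono) auto
    thus ?thesis using C that by force
  qed
  thus "bdd_above ((\<lambda>x. cmod (\<phi> x)) ` {x \<in> carrier X. nrm X x \<le> 1})"
    by (intro bdd_aboveI2[of _ _ "\<bar>C\<bar>"]) auto
qed (use x in simp)

lemma dual_norm_le:
  assumes "complex_banach_space X"
    and "\<And>x. x \<in> carrier X \<Longrightarrow> nrm X x \<le> 1 \<Longrightarrow> cmod (\<phi> x) \<le> C"
  shows "nrm (dual_bimodule X) \<phi> \<le> C"
proof -
  interpret complex_banach_space X by fact
  \<comment> \<open>The zero vector keeps the supremum from ranging over the empty set.\<close>
  have "\<zero>\<^bsub>X\<^esub> \<in> {x \<in> carrier X. nrm X x \<le> 1}" by (simp add: nrm_zero)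
  hence "{x \<in> carrier X. nrm X x \<le> 1} \<noteq> {}" by blast
  thus ?thesis unfolding dual_simps using assms(2) by (intro cSUP_least) auto
qed

end

context banach_bimodule
begin

lemma dual_lact_closed:
  assumes a: "a \<in> carrier A" and \<phi>: "\<phi> \<in> carrier (dual_bimodule X)"
  shows "lact (dual_bimodule X) a \<phi> \<in> carrier (dual_bimodule X)"
proof -
  obtain C where C: "\<forall>x\<in>carrier X. cmod (\<phi> x) \<le> C * nrm X x"
    using \<phi> unfolding dual_simps bounded_functional_def by blast
  obtain C' where C': "\<forall>a\<in>carrier A. \<forall>x\<in>carrier X. nrm X (ract X x a) \<le> C' * nrm A a * nrm X x"
    using ract_bounded by blast
  have "cmod (\<phi> (ract X x a)) \<le> (\<bar>C\<bar> * (C' * nrm A a)) * nrm X x" if x: "x \<in> carrier X" for x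
  proof -
    have y: "ract X x a \<in> carrier X" using ract_closed a x by blast
    hence "cmod (\<phi> (ract X x a)) \<le> C * nrm X (ract X x a)" using C by blast
    also have "\<dots> \<le> \<bar>C\<bar> * nrm X (ract X x a)"
      using X.nrm_nonneg[OF y] by (intro mult_right_mono) auto
    also have "\<dots> \<le> \<bar>C\<bar> * (C' * nrm A a * nrm X x)" using C' a x by (intro mult_left_mono) auto
    finally show ?thesis by (simp add: mult.assoc)
  qed
  thus ?thesis using \<phi> a ract_closed ract_add ract_smult
    unfolding dual_simps bounded_functional_def by (auto simp: X.smult_closed complex_ring_def)
qed

lemma dual_ract_closed:
  assumes a: "a \<in> carrier A" and \<phi>: "\<phi> \<in> carrier (dual_bimodule X)"
  shows "ract (dual_bimodule X) \<phi> a \<in> carrier (dual_bimodule X)"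
proof -
  obtain C where C: "\<forall>x\<in>carrier X. cmod (\<phi> x) \<le> C * nrm X x"
    using \<phi> unfolding dual_simps bounded_functional_def by blast
  obtain C' where C': "\<forall>a\<in>carrier A. \<forall>x\<in>carrier X. nrm X (lact X a x) \<le> C' * nrm A a * nrm X x"
    using lact_bounded by blast
  have "cmod (\<phi> (lact X a x)) \<le> (\<bar>C\<bar> * (C' * nrm A a)) * nrm X x" if x: "x \<in> carrier X" for x
  proof -
    have y: "lact X a x \<in> carrier X" using lact_closed a x by blast
    hence "cmod (\<phi> (lact X a x)) \<le> C * nrm X (lact X a x)" using C by blast
    also have "\<dots> \<le> \<bar>C\<bar> * nrm X (lact X a x)"
      using X.nrm_nonneg[OF y] by (intro mult_right_mono) auto
    also have "\<dots> \<le> \<bar>C\<bar> * (C' * nrm A a * nrm X x)" using C' a x by (intro mult_left_mono) auto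
    finally show ?thesis by (simp add: mult.assoc)
  qed
  thus ?thesis using \<phi> a lact_closed lact_add lact_smult
    unfolding dual_simps bounded_functional_def by (auto simp: X.smult_closed complex_ring_def)
qed

text \<open>Finitely many convergences hold eventually at the same time, and an eventual property of
  a proper filter is attained. One functional therefore serves all of \<open>E\<close>; the
  contradiction below uses two elements.\<close>

lemma approximately_inner_finite:
  assumes D: "approximately_inner A (dual_bimodule X) D" "D \<in> carrier A \<rightarrow> carrier (dual_bimodule X)"
    and E: "finite E" "E \<subseteq> carrier A" and e: "e > 0"
  shows "\<exists>\<phi>. bounded_functional X \<phi> \<and> (\<forall>a\<in>E. \<forall>x\<in>carrier X. nrm X x \<le> 1 \<longrightarrow>
    cmod (D a x - (\<phi> (ract X x a) - \<phi> (lact X a x))) \<le> e)"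
proof -
  let ?Y = "dual_bimodule X"
  interpret Y: abelian_group ?Y by (rule abelian_group_dual)
  obtain F where F: "F \<noteq> bot" "\<forall>\<^sub>F \<phi> in F. \<phi> \<in> carrier ?Y"
    and lim: "\<And>a. a \<in> carrier A \<Longrightarrow>
      ((\<lambda>\<phi>. nrm ?Y (D a \<ominus>\<^bsub>?Y\<^esub> (lact ?Y a \<phi> \<ominus>\<^bsub>?Y\<^esub> ract ?Y \<phi> a))) \<longlongrightarrow> 0) F"
    using D(1) unfolding approximately_inner_def by blast
  have "\<forall>\<^sub>F \<phi> in F. \<forall>a\<in>E. nrm ?Y (D a \<ominus>\<^bsub>?Y\<^esub> (lact ?Y a \<phi> \<ominus>\<^bsub>?Y\<^esub> ract ?Y \<phi> a)) < e"
    using E e lim by (intro eventually_ball_finite ballI order_tendstoD(2)[of _ 0]) auto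
  with F(2) have "\<forall>\<^sub>F \<phi> in F. \<phi> \<in> carrier ?Y \<and>
      (\<forall>a\<in>E. nrm ?Y (D a \<ominus>\<^bsub>?Y\<^esub> (lact ?Y a \<phi> \<ominus>\<^bsub>?Y\<^esub> ract ?Y \<phi> a)) < e)"
    by eventually_elim blast
  from eventually_happens'[OF F(1) this] obtain \<phi> where \<phi>: "\<phi> \<in> carrier ?Y"
    and less: "\<And>a. a \<in> E \<Longrightarrow> nrm ?Y (D a \<ominus>\<^bsub>?Y\<^esub> (lact ?Y a \<phi> \<ominus>\<^bsub>?Y\<^esub> ract ?Y \<phi> a)) < e"
    by blast
  have "cmod (D a x - (\<phi> (ract X x a) - \<phi> (lact X a x))) \<le> e"
    if a: "a \<in> E" and x: "x \<in> carrier X" "nrm X x \<le> 1" for a x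
  proof -
    have aA: "a \<in> carrier A" using a E by blast
    note l = dual_lact_closed[OF aA \<phi>] and r = dual_ract_closed[OF aA \<phi>]
    have Da: "D a \<in> carrier ?Y" using D(2) aA by blast
    have d: "lact ?Y a \<phi> \<ominus>\<^bsub>?Y\<^esub> ract ?Y \<phi> a \<in> carrier ?Y" using l r by (rule Y.minus_closed)
    from Y.minus_closed[OF Da d] dual_norm_bound[OF X.complex_banach_space_axioms _ x]
    have "cmod ((D a \<ominus>\<^bsub>?Y\<^esub> (lact ?Y a \<phi> \<ominus>\<^bsub>?Y\<^esub> ract ?Y \<phi> a)) x) < e"
      using less[OF a] by (meson le_less_trans)
    moreover have "(D a \<ominus>\<^bsub>?Y\<^esub> (lact ?Y a \<phi> \<ominus>\<^bsub>?Y\<^esub> ract ?Y \<phi> a)) x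
        = D a x - (\<phi> (ract X x a) - \<phi> (lact X a x))"
      using fun_cong[OF dual_minus[OF Da d], of x] fun_cong[OF dual_minus[OF l r], of x] x(1)
      by (simp add: dual_simps(5,6))
    ultimately show ?thesis by simp
  qed
  thus ?thesis using \<phi> unfolding dual_simps by blast
qed

end


section \<open>Bounded functions on a set with two commuting actions\<close>

text \<open>The point \<open>z\<close> plays the role of a zero for the actions of \<open>S\<close> on \<open>insert z K\<close>; the values of
  \<open>lt\<close> and \<open>rt\<close> elsewhere are irrelevant.\<close>

locale pointed_biaction = semigroup_on S for S :: "('a, 'm) monoid_scheme" (structure) +
  fixes K :: "'q set" and z :: 'q and lt :: "'a \<Rightarrow> 'q \<Rightarrow> 'q" and rt :: "'q \<Rightarrow> 'a \<Rightarrow> 'q"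
  assumes z: "z \<notin> K"
    and lt_closed: "s \<in> carrier S \<Longrightarrow> q \<in> K \<Longrightarrow> lt s q \<in> insert z K"
    and rt_closed: "s \<in> carrier S \<Longrightarrow> q \<in> K \<Longrightarrow> rt q s \<in> insert z K"
    and lt_z: "s \<in> carrier S \<Longrightarrow> lt s z = z"
    and rt_z: "s \<in> carrier S \<Longrightarrow> rt z s = z"
    and lt_mult: "s \<in> carrier S \<Longrightarrow> t \<in> carrier S \<Longrightarrow> q \<in> K \<Longrightarrow> lt (s \<otimes> t) q = lt s (lt t q)"
    and rt_mult: "s \<in> carrier S \<Longrightarrow> t \<in> carrier S \<Longrightarrow> q \<in> K \<Longrightarrow> rt q (s \<otimes> t) = rt (rt q s) t"
    and lt_rt: "s \<in> carrier S \<Longrightarrow> t \<in> carrier S \<Longrightarrow> q \<in> K \<Longrightarrow> rt (lt s q) t = lt s (rt q t)"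
begin

text \<open>The sides are exchanged, \<open>lact\<close> using \<open>rt\<close> and
  \<open>ract\<close> using \<open>lt\<close>, so that on the dual \<open>s\<close> moves the point
  mass at \<open>q\<close> to the one at \<open>lt s q\<close> or \<open>rt q s\<close>. As
  \<open>x z = 0\<close>, a point sent to \<open>z\<close> contributes nothing.\<close>

definition linf :: "('a \<Rightarrow> complex, 'q \<Rightarrow> complex) normed_bimodule" where
  "linf =
    \<lparr>carrier = {x. (\<exists>C. \<forall>q. cmod (x q) \<le> C) \<and> (\<forall>q. q \<notin> K \<longrightarrow> x q = 0)},
     monoid.mult = undefined,
     one = undefined,
     zero = (\<lambda>q. 0),
     add = (\<lambda>x y q. x q + y q),
     smult = (\<lambda>k x q. k * x q),
     nrm = (\<lambda>x. SUP q. cmod (x q)),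
     lact = (\<lambda>f x q. if q \<in> K then pair f (\<lambda>s. x (rt q s)) else 0),
     ract = (\<lambda>x f q. if q \<in> K then pair f (\<lambda>s. x (lt s q)) else 0)\<rparr>"

lemma linf_simps:
  "x \<in> carrier linf \<longleftrightarrow> (\<exists>C. \<forall>q. cmod (x q) \<le> C) \<and> (\<forall>q. q \<notin> K \<longrightarrow> x q = 0)"
  "\<zero>\<^bsub>linf\<^esub> = (\<lambda>q. 0)"
  "x \<oplus>\<^bsub>linf\<^esub> y = (\<lambda>q. x q + y q)"
  "k \<odot>\<^bsub>linf\<^esub> x = (\<lambda>q. k * x q)"
  "nrm linf x = (SUP q. cmod (x q))"
  "lact linf f x = (\<lambda>q. if q \<in> K then pair f (\<lambda>s. x (rt q s)) else 0)"
  "ract linf x f = (\<lambda>q. if q \<in> K then pair f (\<lambda>s. x (lt s q)) else 0)"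
  by (simp_all add: linf_def)

lemma linf_memI:
  assumes "\<And>q. cmod (x q) \<le> C" "\<And>q. q \<notin> K \<Longrightarrow> x q = 0"
  shows "x \<in> carrier linf"
  unfolding linf_simps(1) using assms by blast

lemma linf_bound:
  assumes "x \<in> carrier linf"
  shows "cmod (x q) \<le> nrm linf x"
  unfolding linf_simps(5)
proof (rule cSUP_upper)
  show "bdd_above (range (\<lambda>q. cmod (x q)))"
    using assms by (auto simp: linf_simps(1) bdd_above_def)
qed simp

lemma linf_nonneg: "x \<in> carrier linf \<Longrightarrow> 0 \<le> nrm linf x"
  using order_trans[OF norm_ge_zero linf_bound] .

lemma linf_norm_le: "(\<And>q. cmod (x q) \<le> C) \<Longrightarrow> nrm linf x \<le> C"
  unfolding linf_simps(5) by (rule cSUP_least) auto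

lemma linf_combination:
  assumes "x \<in> carrier linf" "y \<in> carrier linf"
  shows "(\<lambda>q. c * x q + d * y q) \<in> carrier linf"
proof (rule linf_memI)
  show "cmod (c * x q + d * y q) \<le> cmod c * nrm linf x + cmod d * nrm linf y" for q
    using linf_bound[OF assms(1), of q] linf_bound[OF assms(2), of q]
    by (intro order_trans[OF norm_triangle_ineq] add_mono) (simp_all add: norm_mult mult_left_mono)
qed (use assms in \<open>simp add: linf_simps(1)\<close>)

lemma module_linf: "module complex_ring linf"
proof (rule moduleI)
  show "cring complex_ring" by (rule module.axioms(1)[OF module_l1])
  show "abelian_group linf"
  proof (rule abelian_groupI)
    fix x assume "x \<in> carrier linf"
    thus "\<exists>y\<in>carrier linf. y \<oplus>\<^bsub>linf\<^esub> x = \<zero>\<^bsub>linf\<^esub>"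
      using linf_combination[of x x "-1" 0] by (intro bexI[of _ "\<lambda>q. - x q"]) (simp_all add: linf_simps(2,3))
  next
    show "\<zero>\<^bsub>linf\<^esub> \<in> carrier linf" by (rule linf_memI[of _ 0]) (simp_all add: linf_simps(2))
  next
    fix x y assume "x \<in> carrier linf" "y \<in> carrier linf"
    thus "x \<oplus>\<^bsub>linf\<^esub> y \<in> carrier linf"
      using linf_combination[of x y 1 1] by (simp add: linf_simps(3))
  qed (simp_all add: linf_simps(2,3) ac_simps)
next
  fix c x assume "x \<in> carrier linf"
  thus "c \<odot>\<^bsub>linf\<^esub> x \<in> carrier linf"
    using linf_combination[of x x c 0] by (simp add: linf_simps(4))
qed (simp_all add: linf_simps(2,3,4) complex_ring_def algebra_simps)

lemma linf_minus:
  assumes "x \<in> carrier linf" "y \<in> carrier linf"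
  shows "x \<ominus>\<^bsub>linf\<^esub> y = (\<lambda>q. x q - y q)"
proof -
  interpret module complex_ring linf by (rule module_linf)
  have "\<ominus>\<^bsub>linf\<^esub> y = (\<lambda>q. - y q)"
    using assms linf_combination[of y y "-1" 0]
    by (intro M.minus_equality) (simp_all add: linf_simps(2,3))
  thus ?thesis by (simp add: M.minus_eq linf_simps(3))
qed

lemma linf_complete:
  assumes u: "\<And>n. u n \<in> carrier linf"
    and cauchy: "\<And>e. e > 0 \<Longrightarrow> \<exists>N. \<forall>m\<ge>N. \<forall>n\<ge>N. nrm linf (u m \<ominus>\<^bsub>linf\<^esub> u n) < e"
  shows "\<exists>x\<in>carrier linf. (\<lambda>n::nat. nrm linf (u n \<ominus>\<^bsub>linf\<^esub> x)) \<longlonglongrightarrow> 0"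
proof -
  have c: "\<exists>N. \<forall>m\<ge>N. \<forall>n\<ge>N. \<forall>q. cmod (u m q - u n q) < e" if e: "e > 0" for e
  proof -
    have "cmod (u m q - u n q) \<le> nrm linf (u m \<ominus>\<^bsub>linf\<^esub> u n)" for m n q
      using linf_bound[OF linf_combination[OF u[of m] u[of n], of 1 "-1"], of q] u
      by (simp add: linf_minus)
    thus ?thesis using cauchy[OF e] by (meson le_less_trans)
  qed
  have "Cauchy (\<lambda>n. u n q)" for q
    unfolding Cauchy_def dist_norm using c by meson
  hence "\<exists>l. (\<lambda>n. u n q) \<longlonglongrightarrow> l" for q
    using Cauchy_convergent convergent_def by blast
  then obtain x where x: "\<And>q. (\<lambda>n. u n q) \<longlonglongrightarrow> x q" by metis
  have tail: "\<exists>N. \<forall>n\<ge>N. \<forall>q. cmod (u n q - x q) \<le> e" if e: "e > 0" for e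
  proof -
    obtain N where N: "\<And>m n q. m \<ge> N \<Longrightarrow> n \<ge> N \<Longrightarrow> cmod (u m q - u n q) < e"
      using c[OF e] by blast
    have "cmod (u n q - x q) \<le> e" if "n \<ge> N" for n q
    proof (rule tendsto_upperbound)
      show "(\<lambda>m. cmod (u n q - u m q)) \<longlonglongrightarrow> cmod (u n q - x q)"
        by (intro tendsto_intros x)
      show "\<forall>\<^sub>F m in sequentially. cmod (u n q - u m q) \<le> e"
        using N[OF that] unfolding eventually_sequentially by (meson less_imp_le)
    qed simp
    thus ?thesis by blast
  qed
  have x0: "x q = 0" if "q \<notin> K" for q
    using x[of q] u that by (simp add: linf_simps(1) LIMSEQ_const_iff)
  obtain N where N: "\<And>q. cmod (u N q - x q) \<le> 1" using tail[of 1] by auto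
  have "(\<lambda>q. u N q - x q) \<in> carrier linf"
    using N x0 u by (intro linf_memI[of _ 1]) (auto simp: linf_simps(1))
  from linf_combination[OF u[of N] this, of 1 "-1"] have xX: "x \<in> carrier linf" by simp
  have "\<exists>N. \<forall>n\<ge>N. nrm linf (\<lambda>q. u n q - x q) < e" if e: "e > 0" for e
  proof -
    \<comment> \<open>Limits and suprema only preserve \<open>\<le>\<close>; \<open>e / 2\<close>
      ends strictly below \<open>e\<close>.\<close>
    obtain N where "\<And>n q. n \<ge> N \<Longrightarrow> cmod (u n q - x q) \<le> e / 2"
      using tail[of "e / 2"] half_gt_zero[OF e] by blast
    hence "nrm linf (\<lambda>q. u n q - x q) \<le> e / 2" if "n \<ge> N" for n
      using that by (intro linf_norm_le) auto
    thus ?thesis using e by (intro exI[of _ N]) force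
  qed
  moreover have "nrm linf (\<lambda>q. u n q - x q) \<ge> 0" for n
    using linf_nonneg[OF linf_combination[OF u[of n] xX, of 1 "-1"]] by simp
  ultimately have "(\<lambda>n. nrm linf (\<lambda>q. u n q - x q)) \<longlonglongrightarrow> 0"
    by (simp add: LIMSEQ_def)
  thus ?thesis using xX u by (auto simp: linf_minus)
qed

lemma banach_space_linf: "complex_banach_space linf"
proof -
  interpret module complex_ring linf by (rule module_linf)
  show ?thesis
  proof
    fix x assume x: "x \<in> carrier linf"
    show "nrm linf x = 0 \<longleftrightarrow> x = \<zero>\<^bsub>linf\<^esub>"
      using linf_bound[OF x] linf_norm_le[of x 0] linf_nonneg[OF x]
      by (auto simp: linf_simps(2) fun_eq_iff)
    have le: "nrm linf (\<lambda>q. k * y q) \<le> cmod k * nrm linf y" if "y \<in> carrier linf" for k y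
      using linf_bound[OF that] by (intro linf_norm_le) (simp add: norm_mult mult_left_mono)
    show "nrm linf (k \<odot>\<^bsub>linf\<^esub> x) = cmod k * nrm linf x" for k
    proof (cases "k = 0")
      case True
      thus ?thesis by (simp add: linf_simps(4,5))
    next
      case False
      have "(\<lambda>q. k * x q) \<in> carrier linf" using linf_combination[OF x x, of k 0] by simp
      \<comment> \<open>The reverse inequality is the same estimate for the scalar
        \<open>inverse k\<close> and the vector \<open>k x\<close>.\<close>
      from le[OF this, of "inverse k"] have "cmod k * nrm linf x \<le> nrm linf (\<lambda>q. k * x q)"
        using False by (simp add: norm_inverse norm_divide field_simps)
      thus ?thesis using le[OF x, of k] by (simp add: linf_simps(4))
    qed
  next
    fix x y assume "x \<in> carrier linf" "y \<in> carrier linf"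
    thus "nrm linf (x \<oplus>\<^bsub>linf\<^esub> y) \<le> nrm linf x + nrm linf y"
      unfolding linf_simps(3)
      by (intro linf_norm_le order_trans[OF norm_triangle_ineq] add_mono linf_bound)
  qed (rule linf_complete)
qed

text \<open>Only the bound on \<open>x\<close> enters, not the shape of \<open>h\<close>, so both
  actions are instances and have norm constant 1.\<close>

lemma pair_linf:
  assumes f: "f \<in> carrier L" and x: "x \<in> carrier linf"
  shows "(\<lambda>q. if q \<in> K then pair f (\<lambda>s. x (h q s)) else 0) \<in> carrier linf" (is "?y \<in> _")
    and "nrm linf (\<lambda>q. if q \<in> K then pair f (\<lambda>s. x (h q s)) else 0) \<le> nrm L f * nrm linf x"
proof -
  have "nrm linf x \<ge> 0" "nrm L f \<ge> 0"
    using linf_nonneg[OF x] by (simp_all add: l1_simps infsum_nonneg)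
  hence le: "cmod (?y q) \<le> nrm L f * nrm linf x" for q
    using pair_bound[OF f linf_bound[OF x]] by (simp add: mult.commute)
  show "?y \<in> carrier linf" by (rule linf_memI[OF le]) simp
  show "nrm linf ?y \<le> nrm L f * nrm linf x" by (rule linf_norm_le[OF le])
qed

lemmas lact_linf = pair_linf[where h = rt, folded linf_simps(6)]
  and ract_linf = pair_linf[where h = "\<lambda>q s. lt s q", folded linf_simps(7)]

text \<open>Extends the defining formula to \<open>z\<close>, where both sides vanish. This allows
  evaluation at translated points, which may be \<open>z\<close>.\<close>

lemma lact_linf_apply:
  assumes "x \<in> carrier linf" "q \<in> insert z K"
  shows "lact linf f x q = pair f (\<lambda>s. x (rt q s))"
proof (cases "q = z")
  case True
  have "pair f (\<lambda>s. x (rt z s)) = pair f (\<lambda>s. 0)"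
    using assms(1) z by (intro pair_cong) (simp add: rt_z linf_simps(1))
  thus ?thesis using True z by (simp add: linf_simps(6) pair_zero)
qed (use assms(2) in \<open>simp add: linf_simps(6)\<close>)

lemma ract_linf_apply:
  assumes "x \<in> carrier linf" "q \<in> insert z K"
  shows "ract linf x f q = pair f (\<lambda>s. x (lt s q))"
proof (cases "q = z")
  case True
  have "pair f (\<lambda>s. x (lt s z)) = pair f (\<lambda>s. 0)"
    using assms(1) z by (intro pair_cong) (simp add: lt_z linf_simps(1))
  thus ?thesis using True z by (simp add: linf_simps(7) pair_zero)
qed (use assms(2) in \<open>simp add: linf_simps(7)\<close>)

lemma linf_eqI:
  assumes "x \<in> carrier linf" "y \<in> carrier linf" "\<And>q. q \<in> K \<Longrightarrow> x q = y q"
  shows "x = y"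
proof
  show "x q = y q" for q using assms by (cases "q \<in> K") (auto simp: linf_simps(1))
qed

theorem banach_bimodule_linf: "banach_bimodule L linf"
proof (intro banach_bimodule.intro banach_bimodule_axioms.intro banach_algebra_l1 banach_space_linf)
  note bd = linf_bound
  interpret A: banach_algebra L by (rule banach_algebra_l1)
  fix f g x y k assume f: "f \<in> carrier L" and x: "x \<in> carrier linf"
  show "lact linf f x \<in> carrier linf" "ract linf x f \<in> carrier linf"
    using f x by (rule lact_linf ract_linf)+
  show "lact linf f (k \<odot>\<^bsub>linf\<^esub> x) = k \<odot>\<^bsub>linf\<^esub> lact linf f x"
    "ract linf (k \<odot>\<^bsub>linf\<^esub> x) f = k \<odot>\<^bsub>linf\<^esub> ract linf x f"
    "lact linf (k \<odot>\<^bsub>L\<^esub> f) x = k \<odot>\<^bsub>linf\<^esub> lact linf f x"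
    "ract linf x (k \<odot>\<^bsub>L\<^esub> f) = k \<odot>\<^bsub>linf\<^esub> ract linf x f"
    by (simp_all add: linf_simps(4,6,7) l1_simps(4) pair_smult_right pair_smult_left fun_eq_iff)
  { assume "y \<in> carrier linf"
    thus "lact linf f (x \<oplus>\<^bsub>linf\<^esub> y) = lact linf f x \<oplus>\<^bsub>linf\<^esub> lact linf f y"
      "ract linf (x \<oplus>\<^bsub>linf\<^esub> y) f = ract linf x f \<oplus>\<^bsub>linf\<^esub> ract linf y f"
      using pair_add_right[OF f bd[OF x] bd[OF \<open>y \<in> carrier linf\<close>]]
      by (simp_all add: linf_simps(3,6,7) fun_eq_iff) }
  { assume g: "g \<in> carrier L"
    note fg = A.mult_closed[OF f g]
    show "lact linf (f \<oplus>\<^bsub>L\<^esub> g) x = lact linf f x \<oplus>\<^bsub>linf\<^esub> lact linf g x"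
      "ract linf x (f \<oplus>\<^bsub>L\<^esub> g) = ract linf x f \<oplus>\<^bsub>linf\<^esub> ract linf x g"
      using pair_add_left[OF f g bd[OF x]] by (simp_all add: linf_simps(3,6,7) l1_simps(3) fun_eq_iff)
    show "lact linf (f \<otimes>\<^bsub>L\<^esub> g) x = lact linf f (lact linf g x)"
    proof (rule linf_eqI)
      fix q assume q: "q \<in> K"
      have "lact linf (f \<otimes>\<^bsub>L\<^esub> g) x q = pair f (\<lambda>s. pair g (\<lambda>t. x (rt q (s \<otimes> t))))"
        using q by (simp add: linf_simps(6) pair_mult[OF f g bd[OF x]])
      also have "\<dots> = pair f (\<lambda>s. lact linf g x (rt q s))"
        using q rt_closed by (intro pair_cong) (simp add: lact_linf_apply x, simp add: rt_mult cong: pair_cong)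
      finally show "lact linf (f \<otimes>\<^bsub>L\<^esub> g) x q = lact linf f (lact linf g x) q"
        using q by (simp add: linf_simps(6))
    qed (intro lact_linf fg f g x)+
    show "ract linf x (f \<otimes>\<^bsub>L\<^esub> g) = ract linf (ract linf x f) g"
    proof (rule linf_eqI)
      fix q assume q: "q \<in> K"
      have "ract linf x (f \<otimes>\<^bsub>L\<^esub> g) q = pair f (\<lambda>s. pair g (\<lambda>t. x (lt (s \<otimes> t) q)))"
        using q by (simp add: linf_simps(7) pair_mult[OF f g bd[OF x]])
      \<comment> \<open>In \<open>(x f) g\<close> the outer sum belongs to \<open>g\<close>, whereas
        \<open>pair_mult\<close> puts the sum for \<open>f\<close> outside.\<close>
      also have "\<dots> = pair g (\<lambda>t. pair f (\<lambda>s. x (lt (s \<otimes> t) q)))"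
        by (rule pair_swap[OF f g bd[OF x]])
      also have "\<dots> = pair g (\<lambda>t. ract linf x f (lt t q))"
        using q lt_closed by (intro pair_cong) (simp add: ract_linf_apply x, simp add: lt_mult cong: pair_cong)
      finally show "ract linf x (f \<otimes>\<^bsub>L\<^esub> g) q = ract linf (ract linf x f) g q"
        using q by (simp add: linf_simps(7))
    qed (intro ract_linf fg f g x)+
    show "ract linf (lact linf f x) g = lact linf f (ract linf x g)"
    proof (rule linf_eqI)
      fix q assume q: "q \<in> K"
      have "ract linf (lact linf f x) g q = pair g (\<lambda>t. lact linf f x (lt t q))"
        using q by (simp add: linf_simps(7))
      also have "\<dots> = pair g (\<lambda>t. pair f (\<lambda>s. x (rt (lt t q) s)))"
        using q lt_closed by (intro pair_cong) (simp add: lact_linf_apply x)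
      also have "\<dots> = pair f (\<lambda>s. pair g (\<lambda>t. x (rt (lt t q) s)))"
        by (rule pair_swap[OF g f bd[OF x]])
      also have "\<dots> = pair f (\<lambda>s. ract linf x g (rt q s))"
        using q rt_closed by (intro pair_cong) (simp add: ract_linf_apply x, simp add: lt_rt cong: pair_cong)
      finally show "ract linf (lact linf f x) g q = lact linf f (ract linf x g) q"
        using q by (simp add: linf_simps(6))
    qed (intro ract_linf lact_linf fg f g x)+ }
next
  show "\<exists>C. \<forall>f\<in>carrier L. \<forall>x\<in>carrier linf. nrm linf (lact linf f x) \<le> C * nrm L f * nrm linf x"
    "\<exists>C. \<forall>f\<in>carrier L. \<forall>x\<in>carrier linf. nrm linf (ract linf x f) \<le> C * nrm L f * nrm linf x"
    using lact_linf(2) ract_linf(2) by (auto intro: exI[of _ 1])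
qed

end

text \<open>Here \<open>pl s\<close> and \<open>pr s\<close> stand for \<open>s \<cdot> p\<close> and \<open>p \<cdot> s\<close>, where \<open>p\<close> is a further point, outside
  \<open>insert z K\<close>, to which both actions extend. The derivation below is the commutator with the
  point mass at \<open>p\<close>, which itself is no functional on \<open>\<ell>\<^sup>\<infinity>(K)\<close>.\<close>

locale pointed_biaction_outer = pointed_biaction S K z lt rt
  for S :: "('a, 'm) monoid_scheme" (structure)
    and K :: "'q set" and z :: 'q and lt :: "'a \<Rightarrow> 'q \<Rightarrow> 'q" and rt :: "'q \<Rightarrow> 'a \<Rightarrow> 'q" +
  fixes pl pr :: "'a \<Rightarrow> 'q"
  assumes pl_closed: "s \<in> carrier S \<Longrightarrow> pl s \<in> insert z K"
    and pr_closed: "s \<in> carrier S \<Longrightarrow> pr s \<in> insert z K"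
    and pl_mult: "s \<in> carrier S \<Longrightarrow> t \<in> carrier S \<Longrightarrow> pl (s \<otimes> t) = lt s (pl t)"
    and pr_mult: "s \<in> carrier S \<Longrightarrow> t \<in> carrier S \<Longrightarrow> pr (s \<otimes> t) = rt (pr s) t"
    and pl_pr: "s \<in> carrier S \<Longrightarrow> t \<in> carrier S \<Longrightarrow> rt (pl s) t = lt s (pr t)"
begin

definition outer_derivation :: "('a \<Rightarrow> complex) \<Rightarrow> ('q \<Rightarrow> complex) \<Rightarrow> complex" where
  "outer_derivation f x =
     (if x \<in> carrier linf then pair f (\<lambda>s. x (pl s) - x (pr s)) else 0)"

lemma outer_bound:
  assumes "x \<in> carrier linf"
  shows "cmod (x (pl s) - x (pr s)) \<le> 2 * nrm linf x"
  using norm_triangle_ineq4[of "x (pl s)" "x (pr s)"]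
    linf_bound[OF assms, of "pl s"] linf_bound[OF assms, of "pr s"] by simp

lemma outer_derivation_bound:
  assumes "f \<in> carrier L" "x \<in> carrier linf"
  shows "cmod (outer_derivation f x) \<le> 2 * nrm L f * nrm linf x"
  using pair_bound[OF assms(1) outer_bound[OF assms(2)]] assms
  by (simp add: outer_derivation_def mult.commute mult.left_commute)

lemma outer_derivation_closed:
  assumes f: "f \<in> carrier L"
  shows "outer_derivation f \<in> carrier (dual_bimodule linf)"
proof -
  interpret module complex_ring linf by (rule module_linf)
  have "outer_derivation f (x \<oplus>\<^bsub>linf\<^esub> y) = outer_derivation f x + outer_derivation f y"
    if xy: "x \<in> carrier linf" "y \<in> carrier linf" for x y
    using pair_add_right[OF f outer_bound[OF xy(1)] outer_bound[OF xy(2)]] M.a_closed[OF xy] xy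
    by (simp add: outer_derivation_def linf_simps(3) algebra_simps)
  moreover have "outer_derivation f (k \<odot>\<^bsub>linf\<^esub> x) = k * outer_derivation f x"
    if "x \<in> carrier linf" for k x
    using smult_closed[of k x] that pair_smult_right[of f k]
    by (simp add: outer_derivation_def complex_ring_def linf_simps(4) right_diff_distrib[symmetric])
  moreover have "outer_derivation f x = 0" if "x \<notin> carrier linf" for x
    using that by (simp add: outer_derivation_def)
  ultimately show ?thesis
    using outer_derivation_bound[OF f] unfolding dual_simps bounded_functional_def by blast
qed

text \<open>Leibniz rule for a commutator with \<open>p\<close>: the mixed terms
  \<open>f p g\<close> from the two summands cancel, because \<open>pl_pr\<close> says that
  \<open>s p t\<close> does not depend on the bracketing.\<close>

lemma outer_derivation_mult:
  assumes f: "f \<in> carrier L" and g: "g \<in> carrier L" and x: "x \<in> carrier linf"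
  shows "outer_derivation (f \<otimes>\<^bsub>L\<^esub> g) x
    = outer_derivation g (ract linf x f) + outer_derivation f (lact linf g x)"
proof -
  define P where "P h = pair f (\<lambda>s. pair g (\<lambda>t. x (h s t)))" for h
  note bd = linf_bound[OF x] and bd2 = pair_bound[OF _ linf_bound[OF x]]
  have diff: "pair f (\<lambda>s. pair g (\<lambda>t. x (h s t)) - pair g (\<lambda>t. x (h' s t))) = P h - P h'" for h h'
    unfolding P_def by (rule pair_diff_right[OF f]) (rule bd2[OF g])+
  have swap: "P h = pair g (\<lambda>t. pair f (\<lambda>s. x (h s t)))" for h
    unfolding P_def by (rule pair_swap[OF f g bd])
  have "outer_derivation (f \<otimes>\<^bsub>L\<^esub> g) x
      = pair f (\<lambda>s. pair g (\<lambda>t. x (pl (s \<otimes> t)) - x (pr (s \<otimes> t))))"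
    using x by (simp add: outer_derivation_def pair_mult[OF f g outer_bound[OF x]])
  also have "\<dots> = P (\<lambda>s t. pl (s \<otimes> t)) - P (\<lambda>s t. pr (s \<otimes> t))"
    by (subst pair_diff_right[OF g bd bd]) (rule diff)
  also have "\<dots> = P (\<lambda>s t. lt s (pl t)) - P (\<lambda>s t. rt (pr s) t)"
    unfolding P_def by (simp add: pl_mult pr_mult cong: pair_cong)
  finally have 1: "outer_derivation (f \<otimes>\<^bsub>L\<^esub> g) x
      = P (\<lambda>s t. lt s (pl t)) - P (\<lambda>s t. rt (pr s) t)" .
  have "outer_derivation g (ract linf x f)
      = pair g (\<lambda>t. pair f (\<lambda>s. x (lt s (pl t))) - pair f (\<lambda>s. x (lt s (pr t))))"
    using ract_linf(1)[OF f x] pl_closed pr_closed x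
    by (simp add: outer_derivation_def ract_linf_apply cong: pair_cong)
  also have "\<dots> = P (\<lambda>s t. lt s (pl t)) - P (\<lambda>s t. lt s (pr t))"
    unfolding swap by (rule pair_diff_right[OF g]) (rule bd2[OF f])+
  finally have 2: "outer_derivation g (ract linf x f)
      = P (\<lambda>s t. lt s (pl t)) - P (\<lambda>s t. lt s (pr t))" .
  have "outer_derivation f (lact linf g x)
      = pair f (\<lambda>s. pair g (\<lambda>t. x (rt (pl s) t)) - pair g (\<lambda>t. x (rt (pr s) t)))"
    using lact_linf(1)[OF g x] pl_closed pr_closed x
    by (simp add: outer_derivation_def lact_linf_apply cong: pair_cong)
  also have "\<dots> = P (\<lambda>s t. rt (pl s) t) - P (\<lambda>s t. rt (pr s) t)"
    by (rule diff)
  also have "P (\<lambda>s t. rt (pl s) t) = P (\<lambda>s t. lt s (pr t))"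
    unfolding P_def by (simp add: pl_pr cong: pair_cong)
  finally show ?thesis unfolding 1 2 by simp
qed

theorem continuous_derivation_outer:
  "continuous_derivation L (dual_bimodule linf) outer_derivation"
  unfolding continuous_derivation_def
proof (intro conjI ballI allI impI)
  interpret banach_bimodule L linf by (rule banach_bimodule_linf)
  show "outer_derivation \<in> carrier L \<rightarrow> carrier (dual_bimodule linf)"
    using outer_derivation_closed by blast
  fix f assume f: "f \<in> carrier L"
  show "outer_derivation (k \<odot>\<^bsub>L\<^esub> f) = k \<odot>\<^bsub>dual_bimodule linf\<^esub> outer_derivation f" for k
    by (auto simp: outer_derivation_def l1_simps(4) dual_simps pair_smult_left)
  have add: "outer_derivation (f \<oplus>\<^bsub>L\<^esub> g)
      = outer_derivation f \<oplus>\<^bsub>dual_bimodule linf\<^esub> outer_derivation g"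
    if f: "f \<in> carrier L" and g: "g \<in> carrier L" for f g
  proof
    show "outer_derivation (f \<oplus>\<^bsub>L\<^esub> g) x
        = (outer_derivation f \<oplus>\<^bsub>dual_bimodule linf\<^esub> outer_derivation g) x" for x
      using pair_add_left[OF f g, of "\<lambda>s. x (pl s) - x (pr s)", OF outer_bound]
      by (simp add: outer_derivation_def l1_simps(3) dual_simps)
  qed
  { fix g assume g: "g \<in> carrier L"
    show "outer_derivation (f \<oplus>\<^bsub>L\<^esub> g)
        = outer_derivation f \<oplus>\<^bsub>dual_bimodule linf\<^esub> outer_derivation g"
      by (rule add[OF f g])
    show "outer_derivation (f \<otimes>\<^bsub>L\<^esub> g) = lact (dual_bimodule linf) f (outer_derivation g)
        \<oplus>\<^bsub>dual_bimodule linf\<^esub> ract (dual_bimodule linf) (outer_derivation f) g"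
    proof
      fix x
      show "outer_derivation (f \<otimes>\<^bsub>L\<^esub> g) x = (lact (dual_bimodule linf) f (outer_derivation g)
        \<oplus>\<^bsub>dual_bimodule linf\<^esub> ract (dual_bimodule linf) (outer_derivation f) g) x"
        using outer_derivation_mult[OF f g, of x]
        by (cases "x \<in> carrier linf") (simp_all add: dual_simps, simp add: outer_derivation_def)
    qed }
  fix e :: real assume e: "e > 0"
  \<comment> \<open>The Lipschitz constant 2 turns \<open>e / 4\<close> into \<open>e / 2\<close>,
    which leaves room for the strict inequality.\<close>
  have "nrm (dual_bimodule linf) (outer_derivation g \<ominus>\<^bsub>dual_bimodule linf\<^esub> outer_derivation f) < e"
    if g: "g \<in> carrier L" and small: "nrm L (g \<ominus>\<^bsub>L\<^esub> f) < e / 4" for g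
  proof -
    let ?d = "g \<ominus>\<^bsub>L\<^esub> f"
    have d: "?d \<in> carrier L" using f g by (rule A.M.minus_closed[rotated])
    have "g = ?d \<oplus>\<^bsub>L\<^esub> f" using f g by (simp add: l1_minus l1_simps(3))
    hence "outer_derivation g x - outer_derivation f x = outer_derivation ?d x" for x
      using add[OF d f] by (simp add: dual_simps)
    hence "outer_derivation g \<ominus>\<^bsub>dual_bimodule linf\<^esub> outer_derivation f = outer_derivation ?d"
      using outer_derivation_closed[OF f] outer_derivation_closed[OF g] by (simp add: dual_minus)
    moreover have "nrm (dual_bimodule linf) (outer_derivation ?d) \<le> e / 2"
    proof (rule dual_norm_le[OF banach_space_linf])
      fix x assume x: "x \<in> carrier linf" "nrm linf x \<le> 1"
      have "cmod (outer_derivation ?d x) \<le> 2 * nrm L ?d * nrm linf x"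
        by (rule outer_derivation_bound[OF d x(1)])
      also have "\<dots> \<le> 2 * (e / 4) * 1"
        using small x(2) linf_nonneg[OF x(1)] A.nrm_nonneg[OF d] e by (intro mult_mono) auto
      finally show "cmod (outer_derivation ?d x) \<le> e / 2" by simp
    qed
    ultimately show ?thesis using e by simp
  qed
  thus "\<exists>d>0. \<forall>g\<in>carrier L. nrm L (g \<ominus>\<^bsub>L\<^esub> f) < d \<longrightarrow>
      nrm (dual_bimodule linf) (outer_derivation g \<ominus>\<^bsub>dual_bimodule linf\<^esub> outer_derivation f) < e"
    using e by (intro exI[of _ "e / 4"]) simp
qed

end


section \<open>The derivation of a Brandt semigroup\<close>

text \<open>\<open>Some i\<close> stands for the index \<open>i\<close> and \<open>None\<close> for the point at infinity. The pair \<open>(None, None)\<close>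
  is removed from \<open>K\<close> because the commutator with its point mass shall be outer; its code is
  reused for the zero \<open>z\<close>, so the actions below send it to itself.\<close>

definition brandt_left :: "('i, 'g) brandt \<Rightarrow> 'i option \<times> 'i option \<Rightarrow> 'i option \<times> 'i option" where
  "brandt_left s p = (case s of None \<Rightarrow> (None, None) | Some (i, g, j) \<Rightarrow>
     if p \<noteq> (None, None) \<and> fst p \<in> {Some j, None} then (Some i, snd p) else (None, None))"

text \<open>As in \<open>brandt_left\<close>, a coordinate at infinity stands for the all-ones
  vector. A matrix unit sends this vector to a basis vector, so \<open>None\<close> is replaced by
  an index just as a matching coordinate is.\<close>

definition brandt_right :: "'i option \<times> 'i option \<Rightarrow> ('i, 'g) brandt \<Rightarrow> 'i option \<times> 'i option" where
  "brandt_right p s = (case s of None \<Rightarrow> (None, None) | Some (i, g, j) \<Rightarrow>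
     if p \<noteq> (None, None) \<and> snd p \<in> {Some i, None} then (fst p, Some j) else (None, None))"

text \<open>The matrix unit at \<open>(i, j)\<close> times the all-ones matrix has ones exactly in
  row \<open>i\<close>, which is the point \<open>(Some i, None)\<close>. The product in the other
  order gives column \<open>j\<close> in \<open>brandt_column\<close>.\<close>

definition brandt_row :: "('i, 'g) brandt \<Rightarrow> 'i option \<times> 'i option" where
  "brandt_row s = (case s of None \<Rightarrow> (None, None) | Some (i, g, j) \<Rightarrow> (Some i, None))"

definition brandt_column :: "('i, 'g) brandt \<Rightarrow> 'i option \<times> 'i option" where
  "brandt_column s = (case s of None \<Rightarrow> (None, None) | Some (i, g, j) \<Rightarrow> (None, Some j))"

lemmas brandt_action_defs =
  brandt_left_def brandt_right_def brandt_row_def brandt_column_def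

text \<open>The injection \<open>\<iota>\<close> moves the points into a prescribed type, as \<open>approximately_amenable\<close> fixes the
  type of the elements of the bimodules.\<close>

locale brandt_points = group G for G :: "('g, 'm) monoid_scheme" (structure) +
  fixes I :: "'i set" and \<iota> :: "'i option \<times> 'i option \<Rightarrow> 'q"
  assumes inj: "inj \<iota>"

sublocale brandt_points \<subseteq> pointed_biaction_outer "brandt_semigroup G I"
  "\<iota> ` (- {(None, None)})" "\<iota> (None, None)"
  "\<lambda>s q. \<iota> (brandt_left s (the_inv \<iota> q))" "\<lambda>q s. \<iota> (brandt_right (the_inv \<iota> q) s)"
  "\<lambda>s. \<iota> (brandt_row s)" "\<lambda>s. \<iota> (brandt_column s)"
proof -
  interpret semigroup_on "brandt_semigroup G I"
    by (rule semigroup_brandt) (rule group_axioms)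
  \<comment> \<open>Together with \<open>z\<close> the points exhaust the range of
    \<open>\<iota>\<close>, so closure under the actions is immediate.\<close>
  have K: "insert (\<iota> (None, None)) (\<iota> ` (- {(None, None)})) = range \<iota>" by auto
  show "pointed_biaction_outer (brandt_semigroup G I)
    (\<iota> ` (- {(None, None)})) (\<iota> (None, None))
    (\<lambda>s q. \<iota> (brandt_left s (the_inv \<iota> q))) (\<lambda>q s. \<iota> (brandt_right (the_inv \<iota> q) s))
    (\<lambda>s. \<iota> (brandt_row s)) (\<lambda>s. \<iota> (brandt_column s))"
  proof (unfold_locales, unfold K)
    show "\<iota> (None, None) \<notin> \<iota> ` (- {(None, None)})" using inj by (auto simp: inj_eq)
  qed (auto simp: the_inv_f_f[OF inj] brandt_action_defs brandt_semigroup_def split: option.splits)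
qed

section \<open>Diagonal matrices acting on indicator functions\<close>

context brandt_points
begin

lemma carrier_brandt:
  "carrier (brandt_semigroup G I) = insert None (Some ` (I \<times> carrier G \<times> I))"
  by (simp add: brandt_semigroup_def)

text \<open>A lift of the diagonal matrix with entries \<open>c\<close>, supported on the nonzero
  idempotents of the semigroup.\<close>

definition diag :: "('i \<Rightarrow> complex) \<Rightarrow> ('i, 'g) brandt \<Rightarrow> complex" where
  "diag c s = (if s \<in> (\<lambda>i. Some (i, \<one>, i)) ` I then c (fst (the s)) else 0)"

lemma inj_idempotents: "inj_on (\<lambda>i. Some (i, \<one>, i)) I"
  by (rule inj_onI) simp

lemma diag_closed:
  assumes "c abs_summable_on I"
  shows "diag c \<in> carrier L"
proof -
  have "((\<lambda>s. cmod (diag c s)) \<circ> (\<lambda>i. Some (i, \<one>, i))) summable_on I"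
    using assms by (rule summable_on_cong[THEN iffD1, rotated]) (simp add: diag_def)
  hence "(\<lambda>s. cmod (diag c s)) summable_on (\<lambda>i. Some (i, \<one>, i)) ` I"
    by (simp add: summable_on_reindex[OF inj_idempotents])
  hence "(\<lambda>s. cmod (diag c s)) summable_on carrier (brandt_semigroup G I)"
    by (rule summable_on_cong_neutral[THEN iffD1, rotated -1]) (auto simp: diag_def carrier_brandt)
  thus ?thesis by (auto simp: l1_simps diag_def carrier_brandt)
qed

lemma pair_diag: "pair (diag c) h = (\<Sum>\<^sub>\<infinity>i\<in>I. c i * h (Some (i, \<one>, i)))"
proof -
  have "pair (diag c) h = (\<Sum>\<^sub>\<infinity>s\<in>(\<lambda>i. Some (i, \<one>, i)) ` I. diag c s * h s)"
    unfolding pair_def by (rule infsum_cong_neutral) (auto simp: diag_def carrier_brandt)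
  also have "\<dots> = (\<Sum>\<^sub>\<infinity>i\<in>I. c i * h (Some (i, \<one>, i)))"
    unfolding infsum_reindex[OF inj_idempotents] by (rule infsum_cong) (simp add: diag_def)
  finally show ?thesis .
qed

text \<open>Reduces the evaluations below to counting: the sum over the infinite index set collapses
  to the block \<open>M\<close>, on which all terms agree.\<close>

lemma pair_diag_const:
  assumes "finite M" "M \<subseteq> I" "\<And>i. i \<in> M \<Longrightarrow> c i = a"
    and "\<And>i. i \<in> I \<Longrightarrow> h (Some (i, \<one>, i)) = (if i \<in> M then b else 0)"
  shows "pair (diag c) h = of_nat (card M) * (a * b)"
proof -
  have "pair (diag c) h = (\<Sum>\<^sub>\<infinity>i\<in>M. a * b)"
    unfolding pair_diag using assms(2-) by (intro infsum_cong_neutral) auto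
  thus ?thesis using assms(1) by simp
qed

definition test :: "('i option \<times> 'i option) set \<Rightarrow> 'q \<Rightarrow> complex" where
  "test T q = (if q \<in> \<iota> ` T then 1 else 0)"

lemma test_apply [simp]: "test T (\<iota> p) = (if p \<in> T then 1 else 0)"
  using inj by (auto simp: test_def inj_eq)

lemma test_closed:
  assumes "(None, None) \<notin> T"
  shows "test T \<in> carrier linf" and "nrm linf (test T) \<le> 1"
proof -
  have "T \<subseteq> - {(None, None)}" using assms by auto
  hence "test T q = 0" if "q \<notin> \<iota> ` (- {(None, None)})" for q
    using that by (auto simp: test_def)
  thus "test T \<in> carrier linf" by (intro linf_memI[of _ 1]) (simp_all add: test_def)
  show "nrm linf (test T) \<le> 1" by (rule linf_norm_le) (simp add: test_def)
qed

text \<open>At a finite first coordinate in \<open>M\<close> a single diagonal entry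
  \<open>a\<close> acts. At infinity all entries of the block are summed, which gives the factor
  \<open>card M\<close>. Removing \<open>None\<close> from \<open>V\<close> excludes the point
  \<open>z\<close>.\<close>

lemma ract_test:
  assumes M: "finite M" "M \<subseteq> I" "\<And>i. i \<in> M \<Longrightarrow> c i = a"
  shows "ract linf (test (Some ` M \<times> V)) (diag c) =
    (\<lambda>q. a * test (Some ` M \<times> V) q + of_nat (card M) * a * test ({None} \<times> (V - {None})) q)"
proof
  fix q
  show "ract linf (test (Some ` M \<times> V)) (diag c) q =
    a * test (Some ` M \<times> V) q + of_nat (card M) * a * test ({None} \<times> (V - {None})) q"
  proof (cases "q \<in> \<iota> ` (- {(None, None)})")
    case False
    hence "q \<notin> \<iota> ` (Some ` M \<times> V)" "q \<notin> \<iota> ` ({None} \<times> (V - {None}))" by auto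
    thus ?thesis using False by (simp add: linf_simps(7) test_def)
  next
    case True
    then obtain k l where q: "q = \<iota> (k, l)" and kl: "(k, l) \<noteq> (None, None)"
      by (metis ComplD imageE singletonI surj_pair)
    show ?thesis
    proof (cases k)
      case None
      have "pair (diag c) (\<lambda>s. test (Some ` M \<times> V) (\<iota> (brandt_left s (k, l))))
          = of_nat (card M) * (a * (if l \<in> V then 1 else 0))"
        using kl None by (intro pair_diag_const M) (auto simp: brandt_left_def)
      thus ?thesis using True kl None by (simp add: linf_simps(7) q the_inv_f_f[OF inj])
    next
      case (Some i)
      \<comment> \<open>\<open>card (M \<inter> {i})\<close> is 1 or 0 and thus treats indices
        inside and outside \<open>M\<close> together.\<close>
      have "pair (diag c) (\<lambda>s. test (Some ` M \<times> V) (\<iota> (brandt_left s (k, l))))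
          = of_nat (card (M \<inter> {i})) * (a * (if l \<in> V then 1 else 0))"
        using kl Some M by (intro pair_diag_const) (auto simp: brandt_left_def)
      thus ?thesis using True kl Some by (auto simp: linf_simps(7) q the_inv_f_f[OF inj])
    qed
  qed
qed

lemma lact_test:
  assumes N: "finite N" "N \<subseteq> I" "\<And>i. i \<in> N \<Longrightarrow> c i = a"
  shows "lact linf (diag c) (test (U \<times> Some ` N)) =
    (\<lambda>q. a * test (U \<times> Some ` N) q + of_nat (card N) * a * test ((U - {None}) \<times> {None}) q)"
proof
  fix q
  show "lact linf (diag c) (test (U \<times> Some ` N)) q =
    a * test (U \<times> Some ` N) q + of_nat (card N) * a * test ((U - {None}) \<times> {None}) q"
  proof (cases "q \<in> \<iota> ` (- {(None, None)})")
    case False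
    hence "q \<notin> \<iota> ` (U \<times> Some ` N)" "q \<notin> \<iota> ` ((U - {None}) \<times> {None})" by auto
    thus ?thesis using False by (simp add: linf_simps(6) test_def)
  next
    case True
    then obtain k l where q: "q = \<iota> (k, l)" and kl: "(k, l) \<noteq> (None, None)"
      by (metis ComplD imageE singletonI surj_pair)
    show ?thesis
    proof (cases l)
      case None
      have "pair (diag c) (\<lambda>s. test (U \<times> Some ` N) (\<iota> (brandt_right (k, l) s)))
          = of_nat (card N) * (a * (if k \<in> U then 1 else 0))"
        using kl None by (intro pair_diag_const N) (auto simp: brandt_right_def)
      thus ?thesis using True kl None by (simp add: linf_simps(6) q the_inv_f_f[OF inj])
    next
      case (Some i)
      have "pair (diag c) (\<lambda>s. test (U \<times> Some ` N) (\<iota> (brandt_right (k, l) s)))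
          = of_nat (card (N \<inter> {i})) * (a * (if k \<in> U then 1 else 0))"
        using kl Some N by (intro pair_diag_const) (auto simp: brandt_right_def)
      thus ?thesis using True kl Some by (auto simp: linf_simps(6) q the_inv_f_f[OF inj])
    qed
  qed
qed

text \<open>Right multiplication yields a finite second coordinate or the zero point, never a point
  of the tested set.\<close>

lemma lact_test_column: "lact linf f (test (Some ` M \<times> {None})) = (\<lambda>q. 0)"
proof
  fix q
  have "pair f (\<lambda>s. test (Some ` M \<times> {None}) (\<iota> (brandt_right p s))) = pair f (\<lambda>s. 0)" for p
    by (rule pair_cong) (auto simp: brandt_right_def split: option.splits)
  thus "lact linf f (test (Some ` M \<times> {None})) q = 0" by (simp add: linf_simps(6) pair_zero)
qed

text \<open>Rows and columns of ones have a coordinate at infinity and so miss every finite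
  block.\<close>

lemma outer_derivation_test_block: "outer_derivation f (test (Some ` M \<times> Some ` N)) = 0"
proof -
  have "pair f (\<lambda>s. test (Some ` M \<times> Some ` N) (\<iota> (brandt_row s))
      - test (Some ` M \<times> Some ` N) (\<iota> (brandt_column s))) = pair f (\<lambda>s. 0)"
    by (rule pair_cong) (auto simp: brandt_row_def brandt_column_def split: option.splits)
  thus ?thesis by (simp add: outer_derivation_def pair_zero)
qed

lemma outer_derivation_test_column:
  assumes M: "finite M" "M \<subseteq> I" "\<And>i. i \<in> M \<Longrightarrow> c i = a"
  shows "outer_derivation (diag c) (test (Some ` M \<times> {None})) = of_nat (card M) * a"
proof -
  have "pair (diag c) (\<lambda>s. test (Some ` M \<times> {None}) (\<iota> (brandt_row s))
      - test (Some ` M \<times> {None}) (\<iota> (brandt_column s))) = of_nat (card M) * (a * 1)"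
    by (rule pair_diag_const[OF M]) (auto simp: brandt_row_def brandt_column_def)
  thus ?thesis using test_closed(1)[of "Some ` M \<times> {None}"] by (auto simp: outer_derivation_def)
qed

section \<open>Inequalities for an approximately implementing functional\<close>

lemma functional_combination:
  assumes "bounded_functional linf \<phi>" "x \<in> carrier linf" "y \<in> carrier linf"
  shows "\<phi> (\<lambda>q. c * x q + d * y q) = c * \<phi> x + d * \<phi> y"
proof -
  interpret module complex_ring linf by (rule module_linf)
  have "c \<odot>\<^bsub>linf\<^esub> x \<in> carrier linf" "d \<odot>\<^bsub>linf\<^esub> y \<in> carrier linf"
    using assms smult_closed by (simp_all add: complex_ring_def)
  hence "\<phi> (c \<odot>\<^bsub>linf\<^esub> x \<oplus>\<^bsub>linf\<^esub> d \<odot>\<^bsub>linf\<^esub> y) = c * \<phi> x + d * \<phi> y"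
    using assms unfolding bounded_functional_def by simp
  thus ?thesis by (simp add: linf_simps(3,4))
qed

text \<open>The left action kills the test function and the right action multiplies it by
  \<open>a\<close>, so this compares the value of the functional with \<open>card M\<close>. It
  anchors the chain of estimates at its first block.\<close>

lemma inner_defect_column:
  assumes \<phi>: "bounded_functional linf \<phi>"
    and approx: "\<And>x. x \<in> carrier linf \<Longrightarrow> nrm linf x \<le> 1 \<Longrightarrow>
      cmod (outer_derivation (diag c) x - (\<phi> (ract linf x (diag c)) - \<phi> (lact linf (diag c) x))) \<le> e"
    and M: "finite M" "M \<subseteq> I" "\<And>i. i \<in> M \<Longrightarrow> c i = a"
  shows "cmod (a * (of_nat (card M) - \<phi> (test (Some ` M \<times> {None})))) \<le> e"
proof -
  let ?y = "test (Some ` M \<times> {None}) :: 'q \<Rightarrow> complex"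
  have y: "?y \<in> carrier linf" "nrm linf ?y \<le> 1" by (auto intro!: test_closed)
  have 0: "\<phi> (\<lambda>q. 0) = 0"
    using functional_combination[OF \<phi> y(1) y(1), of 0 0] by simp
  \<comment> \<open>For \<open>V = {None}\<close> the boundary term of \<open>ract_test\<close> is
    empty; the zero summand fits \<open>functional_combination\<close>.\<close>
  have "ract linf ?y (diag c) = (\<lambda>q. a * ?y q + 0 * ?y q)"
    using ract_test[OF M, where V = "{None}"] by (simp add: test_def fun_eq_iff)
  hence "\<phi> (ract linf ?y (diag c)) = a * \<phi> ?y"
    using functional_combination[OF \<phi> y(1) y(1), of a 0] by simp
  with approx[OF y] show ?thesis
    by (simp add: lact_test_column outer_derivation_test_column[OF M] 0 algebra_simps)
qed

text \<open>The derivation vanishes on blocks, so the commutator of the functional alone is small.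
  It links the values on row and column indicators through the value on the block.\<close>

lemma inner_defect_block:
  assumes \<phi>: "bounded_functional linf \<phi>"
    and approx: "\<And>x. x \<in> carrier linf \<Longrightarrow> nrm linf x \<le> 1 \<Longrightarrow>
      cmod (outer_derivation (diag c) x - (\<phi> (ract linf x (diag c)) - \<phi> (lact linf (diag c) x))) \<le> e"
    and M: "finite M" "M \<subseteq> I" "\<And>i. i \<in> M \<Longrightarrow> c i = a"
    and N: "finite N" "N \<subseteq> I" "\<And>i. i \<in> N \<Longrightarrow> c i = b"
  shows "cmod (a * (\<phi> (test (Some ` M \<times> Some ` N)) + of_nat (card M) * \<phi> (test ({None} \<times> Some ` N)))
    - b * (\<phi> (test (Some ` M \<times> Some ` N)) + of_nat (card N) * \<phi> (test (Some ` M \<times> {None})))) \<le> e"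
proof -
  let ?x = "test (Some ` M \<times> Some ` N) :: 'q \<Rightarrow> complex"
  let ?y = "test (Some ` M \<times> {None}) :: 'q \<Rightarrow> complex"
  let ?w = "test ({None} \<times> Some ` N) :: 'q \<Rightarrow> complex"
  have x: "?x \<in> carrier linf" "nrm linf ?x \<le> 1" and y: "?y \<in> carrier linf"
    and w: "?w \<in> carrier linf" by (auto intro!: test_closed)
  have "Some ` N - {None} = Some ` N" "Some ` M - {None} = Some ` M" by auto
  hence "\<phi> (ract linf ?x (diag c)) = a * \<phi> ?x + of_nat (card M) * a * \<phi> ?w"
    "\<phi> (lact linf (diag c) ?x) = b * \<phi> ?x + of_nat (card N) * b * \<phi> ?y"
    using functional_combination[OF \<phi> x(1)] w y by (simp_all add: ract_test[OF M] lact_test[OF N])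
  with approx[OF x] show ?thesis
    by (simp add: outer_derivation_test_block norm_minus_commute algebra_simps)
qed

end

text \<open>Telescoping; the bound is the exact partial sum of the geometric series.\<close>

lemma geometric_chain_bound:
  fixes Z :: "nat \<Rightarrow> complex"
  assumes "\<And>k. cmod (Z (Suc k) - Z k) \<le> c * (1 / 2) ^ k"
  shows "cmod (Z n - Z 0) \<le> 2 * c * (1 - (1 / 2) ^ n)"
proof (induction n)
  case (Suc n)
  have "cmod (Z (Suc n) - Z 0) \<le> cmod (Z (Suc n) - Z n) + cmod (Z n - Z 0)"
    using norm_triangle_ineq[of "Z (Suc n) - Z n" "Z n - Z 0"] by simp
  also have "\<dots> \<le> c * (1 / 2) ^ n + 2 * c * (1 - (1 / 2) ^ n)"
    using assms Suc by (rule add_mono)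
  finally show ?case by (simp add: algebra_simps)
qed simp

text \<open>Block \<open>k\<close> has \<open>4 ^ k\<close> points of weight
  \<open>1 / 8 ^ k\<close>, in total \<open>(1 / 2) ^ k\<close>, hence absolute summability. The
  predicate \<open>P\<close> selects the blocks carrying weight.\<close>

lemma block_weights:
  fixes e :: "nat \<times> nat \<Rightarrow> 'i"
  assumes e: "inj e" "range e \<subseteq> I"
  obtains c :: "'i \<Rightarrow> complex" where "c abs_summable_on I"
    "\<And>k i. i \<in> e ` ({k} \<times> {..<4 ^ k}) \<Longrightarrow> c i = (if P k then 1 / 8 ^ k else 0)"
proof
  define T :: "(nat \<times> nat) set" where "T = Sigma {k. P k} (\<lambda>k. {..<4 ^ k})"
  define c :: "'i \<Rightarrow> complex" where "c i = (if i \<in> e ` T then 1 / 8 ^ fst (the_inv e i) else 0)" for i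
  have c: "c (e p) = (if p \<in> T then 1 / 8 ^ fst p else 0)" for p
    using e(1) by (auto simp: c_def inj_eq the_inv_f_f)
  show "c i = (if P k then 1 / 8 ^ k else 0)" if "i \<in> e ` ({k} \<times> {..<4 ^ k})" for i k
    using that by (auto simp: c T_def)
  have "(\<lambda>p. 1 / 8 ^ fst p :: real) abs_summable_on T"
    unfolding T_def abs_summable_on_Sigma_iff
  proof (intro conjI ballI)
    have "summable (\<lambda>k. norm ((1 / 2) ^ k :: real))" by (simp add: summable_geometric)
    hence "(\<lambda>k. (1 / 2) ^ k :: real) summable_on {k. P k}"
      by (rule summable_on_subset_banach[OF norm_summable_imp_summable_on]) simp
    moreover have "(\<Sum>\<^sub>\<infinity>j\<in>{..<4 ^ k}. norm (1 / 8 ^ fst (k, j :: nat) :: real)) = (1 / 2) ^ k" for k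
      using power_mult_distrib[of "4 :: real" 2 k] by (simp add: field_simps)
    ultimately show "(\<lambda>k. \<Sum>\<^sub>\<infinity>j\<in>{..<4 ^ k}. norm (1 / 8 ^ fst (k, j :: nat) :: real))
        abs_summable_on {k. P k}"
      by (simp add: summable_on_iff_abs_summable_on_real[symmetric])
  qed simp
  hence "((\<lambda>i. norm (c i)) \<circ> e) summable_on T"
    by (rule summable_on_cong[THEN iffD1, rotated]) (simp add: c norm_divide norm_power)
  hence "(\<lambda>i. norm (c i)) summable_on e ` T"
    using e(1) by (simp add: summable_on_reindex inj_on_subset)
  thus "c abs_summable_on I"
    by (rule summable_on_cong_neutral[THEN iffD1, rotated -1]) (use e(2) in \<open>auto simp: c_def\<close>)
qed

section \<open>The contradiction along the chain of blocks\<close>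

context brandt_points
begin

theorem outer_derivation_not_approximately_inner:
  assumes "infinite I"
  shows "\<not> approximately_inner L (dual_bimodule linf) outer_derivation"
proof
  assume inner: "approximately_inner L (dual_bimodule linf) outer_derivation"
  interpret banach_bimodule L linf by (rule banach_bimodule_linf)
  obtain e' :: "nat \<Rightarrow> 'i" where e': "inj e'" "range e' \<subseteq> I"
    using assms infinite_countable_subset by blast
  \<comment> \<open>Pair coding makes the sequence doubly indexed; block \<open>k\<close> is cut
    from row \<open>k\<close>, so the blocks are disjoint.\<close>
  define e where "e = e' \<circ> prod_encode"
  have e: "inj e" "range e \<subseteq> I"
    unfolding e_def using e' inj_compose[OF e'(1) inj_prod_encode] by auto
  define B where "B k = e ` ({k} \<times> {..<4 ^ k})" for k
  have B: "finite (B k)" "B k \<subseteq> I" "card (B k) = 4 ^ k" for k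
    using e by (auto simp: B_def card_image inj_on_subset)
  obtain c :: "'i \<Rightarrow> complex" where c: "c abs_summable_on I"
    and cB: "\<And>k i. i \<in> B k \<Longrightarrow> c i = (if even k then 1 / 8 ^ k else 0)"
    by (rule block_weights[OF e, where P = even]) (simp add: B_def)
  obtain d :: "'i \<Rightarrow> complex" where d: "d abs_summable_on I"
    and dB: "\<And>k i. i \<in> B k \<Longrightarrow> d i = (if odd k then 1 / 8 ^ k else 0)"
    by (rule block_weights[OF e, where P = odd]) (simp add: B_def)
  have E: "finite {diag c, diag d}" "{diag c, diag d} \<subseteq> carrier L"
    using diag_closed[OF c] diag_closed[OF d] by auto
  have D: "outer_derivation \<in> carrier L \<rightarrow> carrier (dual_bimodule linf)"
    using outer_derivation_closed by blast
  \<comment> \<open>With tolerance \<open>1 / 12\<close> the first link costs \<open>1 / 12\<close>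
    and all later ones at most \<open>3 / 8\<close>, together
    \<open>11 / 24 < 1 / 2\<close>.\<close>
  obtain \<phi> where \<phi>: "bounded_functional linf \<phi>"
    and approx: "\<forall>a\<in>{diag c, diag d}. \<forall>x\<in>carrier linf. nrm linf x \<le> 1 \<longrightarrow>
       cmod (outer_derivation a x - (\<phi> (ract linf x a) - \<phi> (lact linf a x))) \<le> 1 / 12"
    using approximately_inner_finite[OF inner D E, of "1 / 12"] by auto
  have approx_c: "cmod (outer_derivation (diag c) x
      - (\<phi> (ract linf x (diag c)) - \<phi> (lact linf (diag c) x))) \<le> 1 / 12"
    and approx_d: "cmod (outer_derivation (diag d) x
      - (\<phi> (ract linf x (diag d)) - \<phi> (lact linf (diag d) x))) \<le> 1 / 12"
    if "x \<in> carrier linf" "nrm linf x \<le> 1" for x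
    using that approx by blast+
  define y where "y k = \<phi> (test (Some ` B k \<times> {None}))" for k
  define w where "w k = \<phi> (test ({None} \<times> Some ` B k))" for k
  define Z where "Z k = (if even k then y k else w k) / 4 ^ k" for k
  have eq: "cmod (4 ^ m * w n - 4 ^ n * y m) \<le> (8 ^ m + 8 ^ n) / 12" if "even m" "odd n" for m n
  proof -
    \<comment> \<open>As \<open>c\<close> vanishes on \<open>B n\<close> and \<open>d\<close> on
      \<open>B m\<close>, each inequality keeps one weight, and \<open>x\<close> cancels in their
      difference.\<close>
    define x where "x = \<phi> (test (Some ` B m \<times> Some ` B n))"
    have "cmod (1 / 8 ^ m * (x + 4 ^ m * w n)) \<le> 1 / 12"
      using inner_defect_block[OF \<phi> approx_c B(1,2)[of m] cB[of _ m] B(1,2)[of n] cB[of _ n]] that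
      by (simp add: B(3) x_def w_def)
    hence 1: "cmod (x + 4 ^ m * w n) \<le> 8 ^ m / 12"
      by (simp add: norm_divide norm_power field_simps)
    have "cmod (- (1 / 8 ^ n * (x + 4 ^ n * y m))) \<le> 1 / 12"
      using inner_defect_block[OF \<phi> approx_d B(1,2)[of m] dB[of _ m] B(1,2)[of n] dB[of _ n]] that
      by (simp add: B(3) x_def y_def)
    hence 2: "cmod (x + 4 ^ n * y m) \<le> 8 ^ n / 12"
      by (simp add: norm_divide norm_power field_simps)
    show ?thesis
      using norm_triangle_ineq4[of "x + 4 ^ m * w n" "x + 4 ^ n * y m"] 1 2 by simp
  qed
  have step: "cmod (Z (Suc k) - Z k) \<le> 3 / 16 * (1 / 2) ^ k" for k
  proof -
    \<comment> \<open>Errors of order \<open>8 ^ k\<close> meet block sizes with product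
      \<open>4 * 16 ^ k\<close>, which leaves a geometric decay; the constant is
      \<open>(1 + 8) / (12 * 4)\<close>.\<close>
    have pw: "(8 ^ k + 8 ^ Suc k) / 12 / (4 ^ k * 4 ^ Suc k) = (3 / 16 * (1 / 2) ^ k :: real)"
    proof -
      have "(8 :: real) ^ k * 2 ^ k = 4 ^ k * 4 ^ k"
        unfolding power_mult_distrib[symmetric] by simp
      thus ?thesis by (simp add: field_simps)
    qed
    have "cmod (Z (Suc k) - Z k) * (4 ^ k * 4 ^ Suc k)
        = cmod ((Z (Suc k) - Z k) * (4 ^ k * 4 ^ Suc k))"
      by (simp add: norm_mult norm_power)
    also have "\<dots> \<le> (8 ^ k + 8 ^ Suc k) / 12"
    proof (cases "even k")
      case True
      hence "(Z (Suc k) - Z k) * (4 ^ k * 4 ^ Suc k) = 4 ^ k * w (Suc k) - 4 ^ Suc k * y k"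
        by (simp add: Z_def field_simps)
      thus ?thesis using eq[of k "Suc k"] True by simp
    next
      \<comment> \<open>The even index is now \<open>Suc k\<close>, so \<open>eq\<close> is used
        with exchanged roles and the sign flips.\<close>
      case False
      hence "(Z (Suc k) - Z k) * (4 ^ k * 4 ^ Suc k) = - (4 ^ Suc k * w k - 4 ^ k * y (Suc k))"
        by (simp add: Z_def field_simps)
      thus ?thesis using eq[of "Suc k" k] False by (simp only: norm_minus_cancel) (simp add: add.commute)
    qed
    finally show ?thesis unfolding pw[symmetric] by (simp add: field_simps)
  qed
  have Z0: "cmod (1 - Z 0) \<le> 1 / 12"
    using inner_defect_column[OF \<phi> approx_c B(1,2)[of 0] cB[of _ 0]] by (simp add: B(3) y_def Z_def)
  have large: "1 / 2 \<le> cmod (Z n)" for n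
  proof -
    have "cmod (Z n - Z 0) \<le> 2 * (3 / 16) * (1 - (1 / 2) ^ n)"
      by (rule geometric_chain_bound) (rule step)
    also have "\<dots> \<le> 3 / 8" by simp
    finally have "cmod (1 - Z n) \<le> 1 / 12 + 3 / 8"
      using Z0 norm_triangle_ineq4[of "1 - Z 0" "Z n - Z 0"] by simp
    thus ?thesis using norm_triangle_ineq2[of 1 "1 - Z n"] by simp
  qed
  obtain C where C: "\<forall>x\<in>carrier linf. cmod (\<phi> x) \<le> C * nrm linf x"
    using \<phi> unfolding bounded_functional_def by blast
  have bound: "cmod (\<phi> (test T)) \<le> \<bar>C\<bar>" if "(None, None) \<notin> T" for T
  proof -
    have "cmod (\<phi> (test T)) \<le> C * nrm linf (test T)"
      using C test_closed(1)[OF that] by blast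
    also have "\<dots> \<le> \<bar>C\<bar> * 1"
      using test_closed[OF that] linf_nonneg by (intro mult_mono) auto
    finally show ?thesis by simp
  qed
  \<comment> \<open>By \<open>large\<close> the unnormalised value has modulus at least
    \<open>4 ^ n / 2\<close>, more than \<open>\<bar>C\<bar>\<close> for this
    \<open>n\<close>.\<close>
  obtain n where n: "2 * \<bar>C\<bar> < 4 ^ n"
    using real_arch_pow[of 4 "2 * \<bar>C\<bar>"] by auto
  have "cmod (if even n then y n else w n) \<le> \<bar>C\<bar>"
    unfolding y_def w_def by (auto intro!: bound)
  hence "cmod (Z n) * 4 ^ n \<le> \<bar>C\<bar>"
    by (simp add: Z_def norm_divide norm_power)
  moreover have "1 / 2 * 4 ^ n \<le> cmod (Z n) * 4 ^ n"
    using large by (intro mult_right_mono) auto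
  ultimately show False using n by simp
qed

end

section \<open>Realising the bimodule in the prescribed type\<close>

theorem mainTheorem3:
  fixes G :: "('g, 'm) monoid_scheme" and I :: "'i set"
  assumes "group G" and "infinite I"
  shows "\<not> approximately_amenable TYPE(('i, 'g) brandt bimodule_universe)
           (l1_algebra (brandt_semigroup G I))"
proof -
  \<comment> \<open>Embeds the indices and infinity into the optional semigroup elements; the middle
    entry is a fixed filler.\<close>
  define code :: "'i option \<Rightarrow> ('i, 'g) brandt option"
    where "code = map_option (\<lambda>i. Some (i, undefined, i))"
  \<comment> \<open>A point becomes the indicator function of its coded pair, so functions on points
    have exactly the type \<open>bimodule_universe\<close>.\<close>
  define \<iota> :: "'i option \<times> 'i option \<Rightarrow> ('i, 'g) brandt option \<times> ('i, 'g) brandt option \<Rightarrow> complex"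
    where "\<iota> p r = (if r = map_prod code code p then 1 else 0)" for p r
  have "inj code"
    unfolding code_def by (rule option.inj_map, rule injI) simp
  from prod.inj_map[OF this this] have "inj (map_prod code code)" .
  moreover have "map_prod code code p = map_prod code code q" if "\<iota> p = \<iota> q" for p q
    using fun_cong[OF that, of "map_prod code code p"] by (simp add: \<iota>_def split: if_splits)
  ultimately have "inj \<iota>" by (meson injD injI)
  then interpret brandt_points G I \<iota>
    using assms(1) by (simp add: brandt_points_def brandt_points_axioms_def)
  show ?thesis
    using banach_bimodule_linf continuous_derivation_outer
      outer_derivation_not_approximately_inner[OF assms(2)]
    unfolding approximately_amenable_def by blast
qed

end
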